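(* Let $s \geq 2$ and $d \geq s$ be integers, and let $P$ be a $d$-dimensional convex polytope with exactly $d+s$ vertices. If $f_k(P) = \phi_k(d+s,d)$ for some $k$ with $1 \leq k \leq d-2$, where \[ \phi_k(d+s,d) := \binom{d+1}{k+1} + \binom{d}{k+1} - \binom{d+1-s}{k+1}, \] then $P$ is combinatorially equivalent to $(T^{d,d-s}_1)^*$, the dual polytope of $T^{d,d-s}_1$.
   Context: For a polytope $P$, $f_k(P)$ denotes the number of $k$-dimensional faces of $P$. $T^s$ denotes an $s$-dimensional simplex. $T^s_1$ denotes the simplicial $s$-polytope obtained as the convex hull of $T^s$ and one additional point lying beyond exactly one facet of $T^s$ (i.e., the supporting hyperplane of exactly one facet of $T^s$ separates the point from $T^s$); equivalently, $T^s_1$ is a bipyramid over an $(s-1)$-simplex. A pyramid over a polytope $Q$ is the convex hull of $Q$ and a point outside the affine hull of $Q$; an $r$-fold pyramid is obtained by iterating this $r$ times (a $0$-fold pyramid is $Q$ itself). $T^{d,d-s}_1$ denotes the $(d-s)$-fold pyramid over $T^s_1$, a $d$-polytope. The dual polytope $Q^*$ of a polytope $Q$ is a polytope (unique up to combinatorial type) whose face lattice is that of $Q$ with the order reversed. Binomial coefficients $\binom{n}{j}$ with $0 \le n < j$ are $0$. *)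

theory Defs
  imports "HOL-Analysis.Analysis"
begin

definition face_count :: "nat \<Rightarrow> 'a::euclidean_space set \<Rightarrow> nat"
  where "face_count k P = card {F. F face_of P \<and> aff_dim F = int k}"

text \<open>
  The set of all \<open>F\<close> with \<open>F face_of P\<close> contains the improper faces \<open>{}\<close> and \<open>P\<close>,
  so ordered by inclusion it is the full face lattice.
\<close>

definition combinatorially_equivalent ::
    "'a::euclidean_space set \<Rightarrow> 'b::euclidean_space set \<Rightarrow> bool"
  where "combinatorially_equivalent P Q \<longleftrightarrow>
    (\<exists>h. bij_betw h {F. F face_of P} {G. G face_of Q} \<and>
         (\<forall>F F'. F face_of P \<longrightarrow> F' face_of P \<longrightarrow> (F \<subseteq> F' \<longleftrightarrow> h F \<subseteq> h F')))"

definition dual_polytope ::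
    "'b::euclidean_space set \<Rightarrow> 'a::euclidean_space set \<Rightarrow> bool"
  where "dual_polytope Q' Q \<longleftrightarrow> polytope Q' \<and>
    (\<exists>h. bij_betw h {F. F face_of Q} {G. G face_of Q'} \<and>
         (\<forall>F F'. F face_of Q \<longrightarrow> F' face_of Q \<longrightarrow> (F \<subseteq> F' \<longleftrightarrow> h F' \<subseteq> h F)))"

text \<open>
  Polytopes need not be full-dimensional in the ambient space. For a point \<open>x\<close> in the affine
  hull of \<open>P\<close>, the side of a hyperplane supporting \<open>P\<close> exactly in the facet \<open>F\<close> on which \<open>x\<close>
  lies does not depend on the chosen hyperplane.
\<close>

definition beyond :: "'a::euclidean_space \<Rightarrow> 'a set \<Rightarrow> 'a set \<Rightarrow> bool"
  where "beyond x F P \<longleftrightarrow> F facet_of P \<and> x \<in> affine hull P \<and>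
    (\<exists>a b. (\<forall>y\<in>P. a \<bullet> y \<le> b) \<and> F = P \<inter> {y. a \<bullet> y = b} \<and> b < a \<bullet> x)"

definition beneath :: "'a::euclidean_space \<Rightarrow> 'a set \<Rightarrow> 'a set \<Rightarrow> bool"
  where "beneath x F P \<longleftrightarrow> F facet_of P \<and> x \<in> affine hull P \<and>
    (\<exists>a b. (\<forall>y\<in>P. a \<bullet> y \<le> b) \<and> F = P \<inter> {y. a \<bullet> y = b} \<and> a \<bullet> x < b)"

text \<open>
  \<open>is_T1 s Q\<close> says that \<open>Q\<close> is a polytope \<open>T\<^sup>s\<^sub>1\<close>. The added point must lie strictly beneath
  the remaining facets: if it lay on the hyperplane of one of them, the hull would not be a
  bipyramid over a simplex (it could even be a simplex again).
\<close>

definition is_T1 :: "nat \<Rightarrow> 'a::euclidean_space set \<Rightarrow> bool"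
  where "is_T1 s Q \<longleftrightarrow>
    (\<exists>T x F. int s simplex T \<and> beyond x F T \<and>
       (\<forall>G. G facet_of T \<and> G \<noteq> F \<longrightarrow> beneath x G T) \<and>
       Q = convex hull (insert x T))"

definition pyramid_over :: "'a::euclidean_space set \<Rightarrow> 'a set \<Rightarrow> bool"
  where "pyramid_over Q R \<longleftrightarrow> (\<exists>x. x \<notin> affine hull Q \<and> R = convex hull (insert x Q))"

definition is_T1_pyramid :: "nat \<Rightarrow> nat \<Rightarrow> 'a::euclidean_space set \<Rightarrow> bool"
  where "is_T1_pyramid s r R \<longleftrightarrow> (\<exists>Q. is_T1 s Q \<and> (pyramid_over ^^ r) Q R)"

end

theory Submission
  imports Defs
begin

text \<open>
  Identify a face of \<open>P\<close> with its vertex set and let its rank be its dimension plus one. If a facet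
  \<open>F\<close> misses \<open>m\<close> vertices, the \<open>k\<close>-faces meeting these are counted one missed vertex at a time: the
  \<open>i\<close>-th one lies in a face of dimension at least \<open>d - i + 1\<close> avoiding the previous ones, hence in at
  least \<open>(d - i + 1) choose k\<close> new \<open>k\<close>-faces. Taking \<open>m \<ge> 2\<close> and applying induction to \<open>F\<close>, the convexity of
  binomial coefficients gives \<open>f\<^sub>k(P) \<ge> \<phi>\<^sub>k(d + s, d)\<close>.

  In the case of equality every facet missing at least two vertices misses exactly \<open>2\<close> or \<open>s\<close> of
  them, and the missed vertices are simple and pairwise adjacent. The remaining vertices are apices
  of \<open>P\<close> as a pyramid. Counting the edges between such a facet and the vertices it misses shows that
  there are \<open>d - s\<close> apices, and double counting of incidences yields the facets of an iterated pyramid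
  over a prism over a simplex. On the other side, the \<open>d + 2\<close> vertices of \<open>T\<^sub>1\<^sup>d\<^sup>,\<^sup>d\<^sup>-\<^sup>s\<close> have a single
  affine dependency, from which its face lattice can be read off and matched with that of \<open>P\<close>.
\<close>

section \<open>Abstract face lattices\<close>

text \<open>The hypothesis concerns one \<open>k\<close> only, so all structure has to be extracted
  from inequalities that are tight in a single rank. This works because an interval of the lattice
  with the least possible number of elements in one intermediate rank already has as many atoms and
  coatoms as a Boolean lattice of its length, each atom missing exactly one coatom. Above a vertex
  this is simplicity, and the later counting uses only the neighbours and facets of such vertices.
  The sizes \<open>2\<close> and \<open>s\<close> come from convexity: a facet missing
  \<open>m\<close> vertices leads to comparing the growth of a binomial coefficient over
  \<open>s - m\<close> steps from two starting points that are \<open>m - 2\<close> apart, so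
  equality leaves distance zero or no step. The lattice is abstract since the induction runs over
  faces and intervals alike, and since the final matching is combinatorial: a face of
  \<open>P\<close> is given by the facets above it, a face of the pyramid by the vertices on it, and
  both families obey the same rule, \<open>circuit_closed\<close>.\<close>

text \<open>
  The elements of \<open>L\<close> are vertex sets of faces, including \<open>{}\<close> and \<open>V\<close>; the rank is the dimension plus one.
\<close>

locale face_lattice =
  fixes V :: "'v set" and L :: "'v set set" and rk :: "'v set \<Rightarrow> nat"
  assumes finite_V: "finite V"
    and face_subset: "F \<in> L \<Longrightarrow> F \<subseteq> V"
    and V_in: "V \<in> L"
    and empty_in: "{} \<in> L"
    and Int_in: "F \<in> L \<Longrightarrow> G \<in> L \<Longrightarrow> F \<inter> G \<in> L"
    and sing_in: "v \<in> V \<Longrightarrow> {v} \<in> L"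
    and rk_empty: "rk {} = 0"
    and rk_sing: "v \<in> V \<Longrightarrow> rk {v} = 1"
    and rk_less: "F \<in> L \<Longrightarrow> G \<in> L \<Longrightarrow> F \<subset> G \<Longrightarrow> rk F < rk G"
    and facet_above: "F \<in> L \<Longrightarrow> G \<in> L \<Longrightarrow> F \<subset> G \<Longrightarrow>
          \<exists>H\<in>L. F \<subseteq> H \<and> H \<subset> G \<and> rk G = Suc (rk H)"
    and diamond: "F \<in> L \<Longrightarrow> H \<in> L \<Longrightarrow> G \<in> L \<Longrightarrow> F \<subset> H \<Longrightarrow> H \<subset> G \<Longrightarrow> rk G = rk F + 2 \<Longrightarrow>
          \<exists>H'\<in>L. H' \<noteq> H \<and> F \<subset> H' \<and> H' \<subset> G"
    and card_edge: "E \<in> L \<Longrightarrow> rk E = 2 \<Longrightarrow> card E = 2"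
begin

definition facets :: "'v set \<Rightarrow> 'v set set"
  where "facets G = {H\<in>L. H \<subseteq> G \<and> rk G = Suc (rk H)}"

definition faces_between :: "'v set \<Rightarrow> 'v set \<Rightarrow> nat \<Rightarrow> 'v set set"
  where "faces_between A G i = {H\<in>L. A \<subseteq> H \<and> H \<subseteq> G \<and> rk H = i}"

lemma finite_L: "finite L"
  by (rule finite_subset[of _ "Pow V"]) (use face_subset finite_V in auto)

lemma finite_between [simp]: "finite (faces_between A G i)"
  unfolding faces_between_def using finite_L by auto

lemma finite_facets [simp]: "finite (facets G)"
  unfolding facets_def using finite_L by auto

lemma finite_face: "F \<in> L \<Longrightarrow> finite F"
  using face_subset finite_V finite_subset by blast

lemma rk_mono: "F \<in> L \<Longrightarrow> G \<in> L \<Longrightarrow> F \<subseteq> G \<Longrightarrow> rk F \<le> rk G"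
  using rk_less by (metis less_imp_le order.refl psubsetI)

lemma face_eqI: "F \<in> L \<Longrightarrow> G \<in> L \<Longrightarrow> F \<subseteq> G \<Longrightarrow> rk G \<le> rk F \<Longrightarrow> F = G"
  using rk_less by (metis leD psubsetI)

lemma facetsD:
  assumes "H \<in> facets G"
  shows "H \<in> L" "H \<subseteq> G" "rk G = Suc (rk H)"
  using assms by (auto simp: facets_def)

lemma ex_facet:
  assumes "F \<in> L" "G \<in> L" "F \<subset> G"
  obtains H where "H \<in> facets G" "F \<subseteq> H"
  using facet_above[OF assms] by (auto simp: facets_def)

lemma facets_eqI: "H \<in> facets G \<Longrightarrow> H' \<in> facets G \<Longrightarrow> H \<subseteq> H' \<Longrightarrow> H = H'"
  by (rule face_eqI) (auto simp: facets_def)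

text \<open>Both faces above \<open>R\<close> have the same rank, so their intersection is strictly
  smaller than \<open>H\<close> and hence equal to \<open>R\<close>. It is
  \<open>H \<inter> H' = R\<close>, not merely \<open>H' \<noteq> H\<close>, that drives the next
  two inductions.\<close>

lemma ex_other_facet:
  assumes "G \<in> L" "H \<in> facets G" "R \<in> facets H"
  obtains H' where "H' \<in> facets G" "H' \<noteq> H" "R \<in> facets H'" "H \<inter> H' = R"
proof -
  note H = facetsD[OF assms(2)] and R = facetsD[OF assms(3)]
  obtain H' where H': "H' \<in> L" "H' \<noteq> H" "R \<subset> H'" "H' \<subset> G"
    using diamond[of R H G] assms(1) H R by (metis lessI add_2_eq_Suc' less_irrefl psubsetI)
  have "rk R < rk H'" "rk H' < rk G" using H' R assms rk_less by auto
  then have rkH': "rk H' = rk H" using H R by auto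
  have "H \<inter> H' \<noteq> H" using face_eqI[of H H'] H' H rkH' by (metis inf.absorb_iff1 order_refl)
  then have "rk (H \<inter> H') < rk H" using rk_less[of "H \<inter> H'" H] H H' Int_in by auto
  then have "R = H \<inter> H'" using face_eqI[of R "H \<inter> H'"] R H H' Int_in by auto
  moreover have "H' \<in> facets G" "R \<in> facets H'"
    using H' rkH' H R by (simp_all add: facets_def psubset_imp_subset)
  ultimately show ?thesis using that H' by metis
qed

text \<open>A facet of \<open>G\<close> above \<open>F\<close> that contains \<open>v\<close> has by
  induction a facet \<open>R\<close> avoiding \<open>v\<close>; the second facet of \<open>G\<close>
  through \<open>R\<close> meets the first one only in \<open>R\<close>, so it avoids
  \<open>v\<close> too. Hence every face is the intersection of the facets above it.\<close>

lemma ex_facet_avoiding: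
  assumes "F \<in> L" "G \<in> L" "F \<subseteq> G" "v \<in> G" "v \<notin> F"
  shows "\<exists>H\<in>facets G. F \<subseteq> H \<and> v \<notin> H"
  using assms
proof (induction "rk G" arbitrary: G rule: less_induct)
  case less
  obtain H where H: "H \<in> facets G" "F \<subseteq> H"
    using ex_facet[of F G] less.prems by blast
  show ?case
  proof (cases "v \<in> H")
    case True
    with less.hyps[of H] H less.prems facetsD[OF H(1)]
    obtain R where R: "R \<in> facets H" "F \<subseteq> R" "v \<notin> R" by auto
    obtain H' where H': "H' \<in> facets G" "H \<inter> H' = R"
      using ex_other_facet[OF less.prems(2) H(1) R(1)] by metis
    then show ?thesis using R True by auto
  qed (use H in auto)
qed

text \<open>The counterpart for atoms of the interval from \<open>A\<close> to \<open>G\<close>: an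
  atom found in the neighbouring facet \<open>G2\<close> outside the ridge
  \<open>G1 \<inter> G2\<close> cannot lie in \<open>G1\<close>.\<close>

lemma ex_atom_outside_facet:
  assumes "A \<in> L" "G \<in> L" "G1 \<in> facets G" "A \<subseteq> G1"
  shows "\<exists>B\<in>faces_between A G (Suc (rk A)). \<not> B \<subseteq> G1"
  using assms
proof (induction "rk G" arbitrary: G G1 rule: less_induct)
  case less
  note G1 = facetsD[OF less.prems(3)]
  show ?case
  proof (cases "A = G1")
    case True
    then show ?thesis using less.prems G1 by (auto simp: faces_between_def intro!: bexI[of _ G])
  next
    case False
    then obtain R where R: "R \<in> facets G1" "A \<subseteq> R"
      using ex_facet[of A G1] G1 less.prems by blast
    obtain G2 where G2: "G2 \<in> facets G" "R \<in> facets G2" "G1 \<inter> G2 = R"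
      using ex_other_facet[OF less.prems(2,3) R(1)] by metis
    obtain B where "B \<in> faces_between A G2 (Suc (rk A))" "\<not> B \<subseteq> R"
      using less.hyps[of G2 R] facetsD[OF G2(1)] G2 R less.prems by auto
    then show ?thesis using G2 facetsD[OF G2(1)] by (intro bexI[of _ B]) (auto simp: faces_between_def)
  qed
qed

lemma ex_between:
  assumes "A \<in> L" "G \<in> L" "A \<subseteq> G" "rk A \<le> i" "i \<le> rk G"
  shows "\<exists>H. H \<in> faces_between A G i"
  using assms
proof (induction "rk G" arbitrary: G rule: less_induct)
  case less
  show ?case
  proof (cases "i = rk G")
    case True
    then show ?thesis using less.prems by (auto simp: faces_between_def)
  next
    case False
    then have "A \<subset> G" using less.prems by auto
    then obtain H where H: "H \<in> facets G" "A \<subseteq> H" using ex_facet less.prems by blast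
    then obtain K where "K \<in> faces_between A H i"
      using less.hyps[of H] facetsD[OF H(1)] less.prems False by auto
    then show ?thesis using facetsD[OF H(1)] by (auto simp: faces_between_def)
  qed
qed

section \<open>Intervals with the least number of elements in a rank\<close>

lemma between_Un_subset:
  assumes "G1 \<in> facets G" "A \<subseteq> B" "\<not> B \<subseteq> G1"
  shows "faces_between A G1 i \<union> faces_between B G i \<subseteq> faces_between A G i"
    and "faces_between A G1 i \<inter> faces_between B G i = {}"
  using assms facetsD[OF assms(1)] by (auto simp: faces_between_def)

text \<open>Pascal's rule: for a facet \<open>G1\<close> of \<open>G\<close> above \<open>A\<close>
  and an atom \<open>B\<close> outside \<open>G1\<close>, the faces below \<open>G1\<close> and
  those above \<open>B\<close> are disjoint families, and both intervals are shorter by one.\<close>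

lemma card_between_ge:
  assumes "A \<in> L" "G \<in> L" "A \<subseteq> G" "rk A \<le> i"
  shows "(rk G - rk A) choose (i - rk A) \<le> card (faces_between A G i)"
  using assms
proof (induction "rk G - rk A" arbitrary: A G)
  case 0
  then have "A = G" using face_eqI by auto
  then show ?case
    using 0 by (cases "i = rk A") (auto simp: faces_between_def card_gt_0_iff Suc_le_eq binomial_eq_0 finite_L)
next
  case (Suc n)
  show ?case
  proof (cases "i = rk A")
    case True
    then have "A \<in> faces_between A G i" using Suc.prems by (auto simp: faces_between_def)
    then show ?thesis using True by (auto simp: Suc_le_eq card_gt_0_iff)
  next
    case False
    then obtain j where j: "i = Suc (rk A + j)"
      using Suc.prems(4) less_imp_Suc_add[of "rk A" i] by auto
    have "A \<subset> G" using Suc by auto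
    then obtain G1 where G1: "G1 \<in> facets G" "A \<subseteq> G1" using ex_facet Suc.prems by blast
    obtain B where B: "B \<in> faces_between A G (Suc (rk A))" "\<not> B \<subseteq> G1"
      using ex_atom_outside_facet[OF Suc.prems(1,2) G1] by auto
    note [simp] = facetsD[OF G1(1)]
    have "n = rk G1 - rk A"
      using Suc.hyps(2) rk_mono[of A G1] G1(2) Suc.prems by simp
    then have "n choose (Suc j) \<le> card (faces_between A G1 i)"
      using Suc.hyps(1)[of G1 A] G1(2) Suc.prems j by simp
    moreover have "n choose j \<le> card (faces_between B G i)"
    proof -
      have "B \<in> L" "A \<subseteq> B" "B \<subseteq> G" "rk B = Suc (rk A)" using B by (auto simp: faces_between_def)
      then show ?thesis using Suc.hyps(1)[of G B] Suc.prems \<open>n = rk G1 - rk A\<close> j by simp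
    qed
    moreover have "card (faces_between A G1 i) + card (faces_between B G i) \<le> card (faces_between A G i)"
      using between_Un_subset[OF G1(1), of A B i] B
      by (subst card_Un_disjoint[symmetric]) (auto simp: faces_between_def intro!: card_mono finite_subset[OF _ finite_L])
    moreover have "(rk G - rk A) choose (i - rk A) = (n choose j) + (n choose Suc j)"
      using Suc.hyps(2)[symmetric] j by simp
    ultimately show ?thesis by linarith
  qed
qed

text \<open>Equality makes both summands of Pascal's rule tight, and together they exhaust the rank
  \<open>i\<close>. A second atom \<open>B'\<close> outside \<open>G1\<close> would lie below a face
  of rank \<open>i\<close> avoiding a point of \<open>B\<close>, which belongs to neither
  summand.\<close>

lemma extremal_interval_aux:
  assumes A: "A \<in> L" "G \<in> L" and i: "rk A < i" "i < rk G"
    and eq: "card (faces_between A G i) = (rk G - rk A) choose (i - rk A)"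
    and G1: "G1 \<in> facets G" "A \<subseteq> G1"
  shows "\<exists>!B. B \<in> faces_between A G (Suc (rk A)) \<and> \<not> B \<subseteq> G1"
    and "card (faces_between A G1 i) = (rk G1 - rk A) choose (i - rk A)"
proof -
  obtain B where B: "B \<in> faces_between A G (Suc (rk A))" "\<not> B \<subseteq> G1"
    using ex_atom_outside_facet[OF A G1] by auto
  note g = facetsD[OF G1(1)]
  have BL: "B \<in> L" "A \<subseteq> B" "B \<subseteq> G" "rk B = Suc (rk A)" using B by (auto simp: faces_between_def)
  obtain j where j: "i = Suc (rk A + j)"
    using i less_imp_Suc_add[of "rk A" i] by auto
  obtain n where n: "rk G = Suc (rk A + n)"
    using i less_imp_Suc_add[of "rk A" "rk G"] by auto
  have "rk G1 - rk A = n" using g(3) n by simp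
  have 1: "n choose Suc j \<le> card (faces_between A G1 i)"
    using card_between_ge[of A G1 i] A(1) g(1) G1(2) j \<open>rk G1 - rk A = n\<close> by simp
  have 2: "n choose j \<le> card (faces_between B G i)"
    using card_between_ge[of B G i] A BL j n by auto
  have 3: "card (faces_between A G i) = (n choose j) + (n choose Suc j)"
    using eq n j by simp
  note U = between_Un_subset[OF G1(1) BL(2) B(2), of i]
  have 4: "card (faces_between A G1 i \<union> faces_between B G i) = card (faces_between A G1 i) + card (faces_between B G i)"
    using U by (intro card_Un_disjoint) auto
  have 5: "card (faces_between A G1 i \<union> faces_between B G i) \<le> card (faces_between A G i)"
    using U by (intro card_mono) auto
  then have all: "faces_between A G1 i \<union> faces_between B G i = faces_between A G i"
    using U 1 2 3 4 by (intro card_subset_eq) auto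
  show "card (faces_between A G1 i) = (rk G1 - rk A) choose (i - rk A)"
    using 1 2 3 4 5 n j g by auto
  show "\<exists>!B. B \<in> faces_between A G (Suc (rk A)) \<and> \<not> B \<subseteq> G1"
  proof (rule ex1I[of _ B])
    fix B' assume B': "B' \<in> faces_between A G (Suc (rk A)) \<and> \<not> B' \<subseteq> G1"
    show "B' = B"
    proof (rule ccontr)
      assume ne: "B' \<noteq> B"
      have B'L: "B' \<in> L" "A \<subseteq> B'" "B' \<subseteq> G" "rk B' = Suc (rk A)" using B' by (auto simp: faces_between_def)
      have "\<not> B \<subseteq> B'" using face_eqI[of B B'] ne BL B'L by auto
      then obtain v where v: "v \<in> B" "v \<notin> B'" by auto
      obtain G2 where G2: "G2 \<in> facets G" "B' \<subseteq> G2" "v \<notin> G2"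
        using ex_facet_avoiding[of B' G v] v B'L BL A by blast
      \<comment> \<open>There is room for rank \<open>i\<close> between the atom \<open>B'\<close>
        and the facet \<open>G2\<close> because \<open>rk A < i < rk G\<close>.\<close>
      obtain H where "H \<in> faces_between B' G2 i"
        using ex_between[of B' G2 i] B'L G2 facetsD[OF G2(1)] i by auto
      then have H: "H \<in> faces_between A G i" "B' \<subseteq> H" "v \<notin> H"
        using G2 facetsD[OF G2(1)] B'L by (auto simp: faces_between_def)
      then have "H \<in> faces_between A G1 i \<or> H \<in> faces_between B G i" using all by blast
      then show False using H B' v by (auto simp: faces_between_def)
    qed
  qed (use B in auto)
qed

text \<open>If two facets missed \<open>B\<close>, one of them would contain an atom outside the
  other; by uniqueness of such atoms this is \<open>B\<close>, which it misses.\<close>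

lemma extremal_interval_coatom_unique:
  assumes A: "A \<in> L" "G \<in> L" and i: "rk A < i" "i < rk G"
    and eq: "card (faces_between A G i) = (rk G - rk A) choose (i - rk A)"
    and B: "B \<in> faces_between A G (Suc (rk A))"
  shows "\<exists>!H. H \<in> facets G \<and> A \<subseteq> H \<and> \<not> B \<subseteq> H"
proof -
  have BL: "B \<in> L" "A \<subseteq> B" "B \<subseteq> G" "rk B = Suc (rk A)" using B by (auto simp: faces_between_def)
  have "\<not> B \<subseteq> A" using BL A rk_mono[of B A] by auto
  then obtain v where v: "v \<in> B" "v \<notin> A" by auto
  obtain H where H: "H \<in> facets G" "A \<subseteq> H" "\<not> B \<subseteq> H"
    using ex_facet_avoiding[of A G v] v BL A by blast
  show ?thesis
  proof (rule ex1I[of _ H])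
    fix H' assume H': "H' \<in> facets G \<and> A \<subseteq> H' \<and> \<not> B \<subseteq> H'"
    show "H' = H"
    proof (rule ccontr)
      assume "H' \<noteq> H"
      then have "H \<inter> H' \<subset> H'" using facets_eqI[of H' G H] H H' by auto
      then obtain R where R: "R \<in> facets H'" "H \<inter> H' \<subseteq> R"
        using ex_facet[of "H \<inter> H'" H'] facetsD[of H G] facetsD[of H' G] Int_in H H' by blast
      obtain C where C: "C \<in> faces_between A H' (Suc (rk A))" "\<not> C \<subseteq> R"
        using ex_atom_outside_facet[of A H' R] R A H H' facetsD[of H' G] by blast
      then have "C \<in> faces_between A G (Suc (rk A))" "\<not> C \<subseteq> H" "C \<subseteq> H'"
        using R H' facetsD[of H' G] by (auto simp: faces_between_def)
      moreover have "C = B"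
        using extremal_interval_aux(1)[OF A i eq H(1,2)] calculation B H by metis
      ultimately show False using H' by auto
    qed
  qed (use H in auto)
qed

text \<open>By the two uniqueness statements, the relation of missing is a perfect matching of atoms
  and coatoms.\<close>

lemma extremal_interval_card_eq:
  assumes A: "A \<in> L" "G \<in> L" "A \<subseteq> G" and i: "rk A < i" "i < rk G"
    and eq: "card (faces_between A G i) = (rk G - rk A) choose (i - rk A)"
  shows "card (faces_between A G (Suc (rk A))) = card {H\<in>facets G. A \<subseteq> H}"
proof -
  let ?m = "\<lambda>B. THE H. H \<in> facets G \<and> A \<subseteq> H \<and> \<not> B \<subseteq> H"
  note ex = extremal_interval_coatom_unique[OF A(1,2) i eq]
  note ax = extremal_interval_aux(1)[OF A(1,2) i eq]
  have m: "?m B \<in> facets G \<and> A \<subseteq> ?m B \<and> \<not> B \<subseteq> ?m B" if "B \<in> faces_between A G (Suc (rk A))" for B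
    using theI'[OF ex[OF that]] .
  have "bij_betw ?m (faces_between A G (Suc (rk A))) {H\<in>facets G. A \<subseteq> H}"
  proof (rule bij_betw_imageI)
    show "inj_on ?m (faces_between A G (Suc (rk A)))"
    proof (rule inj_onI)
      fix B C assume BC: "B \<in> faces_between A G (Suc (rk A))" "C \<in> faces_between A G (Suc (rk A))"
        and e: "?m B = ?m C"
      have "?m B \<in> facets G" "A \<subseteq> ?m B" using m BC by blast+
      then have "\<exists>!D. D \<in> faces_between A G (Suc (rk A)) \<and> \<not> D \<subseteq> ?m B" by (rule ax)
      moreover have "\<not> B \<subseteq> ?m B" "\<not> C \<subseteq> ?m B" using m[OF BC(1)] m[OF BC(2)] e by simp_all
      ultimately show "B = C" using BC by blast
    qed
    show "?m ` faces_between A G (Suc (rk A)) = {H \<in> facets G. A \<subseteq> H}"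
    proof (intro equalityI subsetI)
      fix H assume H: "H \<in> {H \<in> facets G. A \<subseteq> H}"
      then have "H \<in> facets G" "A \<subseteq> H" by simp_all
      from ex1_implies_ex[OF ax[OF this]]
      obtain B where B: "B \<in> faces_between A G (Suc (rk A))" "\<not> B \<subseteq> H" by blast
      then have "?m B = H" using the1_equality[OF ex[OF B(1)]] H by auto
      then show "H \<in> ?m ` faces_between A G (Suc (rk A))" using B by blast
    qed (use m in auto)
  qed
  then show ?thesis by (rule bij_betw_same_card)
qed

text \<open>Equality descends to facets until \<open>i\<close> is the rank of the coatoms. There the
  hypothesis counts the coatoms, and the matching turns this into a count of atoms; each step back
  up adds the single atom outside \<open>G1\<close>.\<close>

lemma extremal_interval_card:
  assumes "A \<in> L" "G \<in> L" "A \<subseteq> G" "rk A < i" "i < rk G"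
    and "card (faces_between A G i) = (rk G - rk A) choose (i - rk A)"
  shows "card (faces_between A G (Suc (rk A))) = rk G - rk A"
  using assms
proof (induction "rk G" arbitrary: G rule: less_induct)
  case less
  have "A \<subset> G" using less.prems by auto
  then obtain G1 where G1: "G1 \<in> facets G" "A \<subseteq> G1" using ex_facet less.prems by blast
  note g = facetsD[OF G1(1)]
  show ?case
  proof (cases "Suc i = rk G")
    case True
    have "card {H\<in>facets G. A \<subseteq> H} = card (faces_between A G i)"
    proof (rule arg_cong[of _ _ card])
      show "{H \<in> facets G. A \<subseteq> H} = faces_between A G i"
        using True by (auto simp: facets_def faces_between_def)
    qed
    also have "\<dots> = rk G - rk A"
    proof -
      have "rk G - rk A = Suc (i - rk A)" using True less.prems by auto
      then show ?thesis using less.prems by (simp only: binomial_Suc_n)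
    qed
    finally show ?thesis using extremal_interval_card_eq less.prems by simp
  next
    case False
    note aux = extremal_interval_aux[OF less.prems(1,2,4,5,6) G1]
    have 1: "card (faces_between A G1 (Suc (rk A))) = rk G1 - rk A"
      using less.hyps[of G1] g G1 less.prems aux(2) False by auto
    obtain B where B: "B \<in> faces_between A G (Suc (rk A))" "\<not> B \<subseteq> G1"
      and un: "\<And>C. C \<in> faces_between A G (Suc (rk A)) \<Longrightarrow> \<not> C \<subseteq> G1 \<Longrightarrow> C = B"
      using aux(1) by (elim ex1E) blast
    have "C \<in> faces_between A G1 (Suc (rk A)) \<longleftrightarrow> C \<in> faces_between A G (Suc (rk A)) \<and> C \<subseteq> G1" for C
      using g(2) by (auto simp: faces_between_def)
    then have "faces_between A G (Suc (rk A)) = insert B (faces_between A G1 (Suc (rk A)))"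
      using B un by blast
    moreover have "B \<notin> faces_between A G1 (Suc (rk A))" using B by (auto simp: faces_between_def)
    ultimately show ?thesis using 1 g less.prems by auto
  qed
qed

section \<open>Faces meeting a set of vertices, and the lower bound\<close>

lemma ex_face_avoiding:
  assumes "G \<in> L" "v \<in> G" "finite W" "v \<notin> W" "card W < rk G"
  shows "\<exists>F\<in>L. F \<subseteq> G \<and> v \<in> F \<and> F \<inter> W = {} \<and> rk G \<le> rk F + card W"
  using assms(3-)
proof (induction W rule: finite_induct)
  case empty
  then show ?case using assms by auto
next
  case (insert w W)
  then obtain F where F: "F \<in> L" "F \<subseteq> G" "v \<in> F" "F \<inter> W = {}" "rk G \<le> rk F + card W" by auto
  show ?case
  proof (cases "w \<in> F")
    case True
    have "{v} \<in> L" using sing_in face_subset F by auto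
    then obtain H where H: "H \<in> facets F" "v \<in> H" "w \<notin> H"
      using ex_facet_avoiding[of "{v}" F w] F True insert.prems by auto
    then show ?thesis using F facetsD[OF H(1)] insert.hyps by (intro bexI[of _ H]) auto
  next
    case False
    then show ?thesis using F insert.hyps by (intro bexI[of _ F]) auto
  qed
qed

definition meeting :: "'v set \<Rightarrow> 'v set \<Rightarrow> nat \<Rightarrow> 'v set set"
  where "meeting S G i = {H\<in>L. H \<subseteq> G \<and> rk H = i \<and> H \<inter> S \<noteq> {}}"

lemma finite_meeting [simp]: "finite (meeting S G i)"
  unfolding meeting_def using finite_L by auto

text \<open>The new faces are sought through \<open>v\<close> inside a face that avoids
  \<open>S\<close>; such a face costs at most one rank for each vertex of \<open>S\<close>.\<close>

lemma card_meeting_insert: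
  assumes "G \<in> L" "v \<in> G" "finite S" "v \<notin> S" "card S < rk G"
  shows "card (meeting S G (Suc i)) + ((rk G - Suc (card S)) choose i) \<le> card (meeting (insert v S) G (Suc i))"
proof -
  obtain F where F: "F \<in> L" "F \<subseteq> G" "v \<in> F" "F \<inter> S = {}" "rk G \<le> rk F + card S"
    using ex_face_avoiding assms by metis
  have v: "{v} \<in> L" "rk {v} = 1" using sing_in rk_sing face_subset F by auto
  have "(rk G - Suc (card S)) choose i \<le> (rk F - 1) choose i"
    using F(5) by (intro binomial_right_mono) auto
  also have "\<dots> \<le> card (faces_between {v} F (Suc i))"
    using card_between_ge[of "{v}" F "Suc i"] v F by auto
  finally have 1: "(rk G - Suc (card S)) choose i \<le> card (faces_between {v} F (Suc i))" .
  have "card (meeting S G (Suc i)) + card (faces_between {v} F (Suc i)) = card (meeting S G (Suc i) \<union> faces_between {v} F (Suc i))"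
    using F by (intro card_Un_disjoint[symmetric] finite_meeting finite_between)
      (auto simp: meeting_def faces_between_def)
  also have "\<dots> \<le> card (meeting (insert v S) G (Suc i))"
    using F by (intro card_mono finite_meeting) (auto simp: meeting_def faces_between_def)
  finally show ?thesis using 1 by linarith
qed

text \<open>The bounds for adding vertices one at a time telescope by Pascal's rule. In the form of
  monotonicity in the set, the lemma also transports equality: equal values for \<open>{}\<close>
  and for \<open>W\<close> force the same value for every set between them.\<close>

lemma card_meeting_mono:
  assumes "G \<in> L" "S \<subseteq> W" "W \<subseteq> G" "card W \<le> rk G"
  shows "card (meeting S G (Suc i)) + ((rk G - card S) choose Suc i)
         \<le> card (meeting W G (Suc i)) + ((rk G - card W) choose Suc i)"
proof -
  have fin: "finite W" "finite S" using assms finite_face finite_subset by metis+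
  have "finite D \<Longrightarrow> D \<subseteq> W - S \<Longrightarrow> card (meeting S G (Suc i)) + ((rk G - card S) choose Suc i)
         \<le> card (meeting (D \<union> S) G (Suc i)) + ((rk G - card (D \<union> S)) choose Suc i)" for D
  proof (induction D rule: finite_induct)
    case (insert v D)
    then have c: "card (insert v (D \<union> S)) = Suc (card (D \<union> S))" using fin by (intro card_insert_disjoint) auto
    have "card (insert v (D \<union> S)) \<le> card W" using insert.prems assms fin by (intro card_mono) auto
    then have lt: "card (D \<union> S) < rk G" using assms c by linarith
    have "card (meeting (D \<union> S) G (Suc i)) + ((rk G - Suc (card (D \<union> S))) choose i)
          \<le> card (meeting (insert v (D \<union> S)) G (Suc i))"
      by (rule card_meeting_insert) (use insert assms fin lt in auto)
    moreover obtain n where n: "rk G - card (D \<union> S) = Suc n" using lt by (metis Suc_diff_Suc)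
    then have "rk G - Suc (card (D \<union> S)) = n" by auto
    ultimately show ?case using insert n c by auto
  qed simp
  from this[of "W - S"] fin assms show ?thesis by (auto simp: Un_absorb2)
qed

lemma rank_one: "faces_between {} G 1 = (\<lambda>v. {v}) ` G" if "G \<in> L"
proof (intro equalityI subsetI)
  fix H assume H: "H \<in> faces_between {} G 1"
  then have "H \<in> L" "H \<subseteq> G" "rk H = 1" by (auto simp: faces_between_def)
  moreover then obtain v where "v \<in> H" using rk_empty by fastforce
  moreover have "v \<in> V" using calculation face_subset by blast
  ultimately have "{v} = H" using face_eqI[of "{v}" H] sing_in rk_sing by simp
  then show "H \<in> (\<lambda>v. {v}) ` G" using \<open>H \<subseteq> G\<close> by auto
next
  fix H assume "H \<in> (\<lambda>v. {v}) ` G"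
  then show "H \<in> faces_between {} G 1" using that face_subset[of G] sing_in rk_sing by (auto simp: faces_between_def)
qed

lemma rk_le_card: "rk G \<le> card G" if "G \<in> L"
proof -
  have "(rk G - rk {}) choose (1 - rk {}) \<le> card (faces_between {} G 1)"
    using that empty_in rk_empty by (intro card_between_ge) auto
  then show ?thesis using that by (simp add: rk_empty rank_one[simplified] card_image)
qed

text \<open>If every facet missed at most one vertex, every \<open>G - {v}\<close> would be a face,
  hence every subset of \<open>G\<close>, and a maximal chain of subsets would give
  \<open>card G \<le> rk G\<close>.\<close>

lemma ex_non_pyramid_facet:
  assumes "G \<in> L" "rk G < card G"
  obtains F where "F \<in> facets G" "2 \<le> card (G - F)"
proof -
  have "\<exists>F\<in>facets G. 2 \<le> card (G - F)"
  proof (rule ccontr)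
    assume "\<not> (\<exists>F\<in>facets G. 2 \<le> card (G - F))"
    then have no: "card (G - F) < 2" if "F \<in> facets G" for F using that by (meson not_le)
    have *: "G - {v} \<in> L" if v: "v \<in> G" for v
    proof -
      obtain F where F: "F \<in> facets G" "v \<notin> F"
        using ex_facet_avoiding[of "{}" G v] assms v empty_in by auto
      have "card (G - F) \<le> Suc 0" using no[OF F(1)] by linarith
      then have "G - F = {v}" using v F finite_face[OF assms(1)] card_le_Suc0_iff_eq[of "G - F"]
        by auto
      then have "F = G - {v}" using facetsD[OF F(1)] by auto
      then show ?thesis using facetsD[OF F(1)] by auto
    qed
    have sub: "G - D \<in> L" if "finite D" "D \<subseteq> G" for D
      using that
    proof (induction D rule: finite_induct)
      case (insert v D)
      then have "G - insert v D = (G - D) \<inter> (G - {v})" by auto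
      then show ?case using insert * Int_in by auto
    qed (use assms in auto)
    have all: "S \<in> L" if "S \<subseteq> G" for S
      using sub[of "G - S"] that finite_face[OF assms(1)] by (auto simp: double_diff)
    have "card S \<le> rk S" if "finite S" "S \<subseteq> G" for S
      using that
    proof (induction S rule: finite_induct)
      case (insert v S)
      then have "rk S < rk (insert v S)" using all by (intro rk_less) auto
      then show ?case using insert by auto
    qed simp
    from this[of G] show False using assms finite_face by auto
  qed
  then show ?thesis using that by blast
qed

end

section \<open>Convexity of binomial coefficients\<close>

lemma choose_convex:
  fixes a b t i :: nat
  assumes "a \<le> b"
  shows "(b choose i) + ((a + t) choose i) \<le> ((b + t) choose i) + (a choose i)"
proof (induction t)
  case (Suc t)
  show ?case
  proof (cases i)
    case (Suc j)
    have "(a + t) choose j \<le> (b + t) choose j" using assms by (intro binomial_right_mono) auto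
    then show ?thesis using Suc.IH Suc by simp
  qed simp
qed simp

lemma choose_strict_mono:
  fixes a b j :: nat
  assumes "a < b" "1 \<le> j" "j \<le> b"
  shows "a choose j < b choose j"
proof -
  obtain c where c: "b = Suc c" using assms by (cases b) auto
  obtain l where l: "j = Suc l" using assms by (cases j) auto
  have "a choose j \<le> c choose j" using assms c by (intro binomial_right_mono) auto
  moreover have "0 < c choose l" using assms c l by (simp add: zero_less_binomial)
  ultimately show ?thesis unfolding c l binomial_Suc_Suc by linarith
qed

lemma choose_strict_convex:
  fixes a b t i :: nat
  assumes "a < b" "1 \<le> t" "2 \<le> i" "i \<le> b + t"
  shows "(b choose i) + ((a + t) choose i) < ((b + t) choose i) + (a choose i)"
proof -
  obtain u where u: "t = Suc u" using assms by (cases t) auto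
  obtain j where j: "i = Suc j" using assms by (cases i) auto
  have "(a + u) choose j < (b + u) choose j" using assms u j by (intro choose_strict_mono) auto
  then show ?thesis using choose_convex[of a b i u] assms u j by simp
qed

context face_lattice begin

lemma card_faces_split:
  assumes "F \<in> facets G"
  shows "card (faces_between {} G i) = card (faces_between {} F i) + card (meeting (G - F) G i)"
proof -
  have "faces_between {} G i = faces_between {} F i \<union> meeting (G - F) G i"
    using facetsD[OF assms] by (auto simp: faces_between_def meeting_def)
  moreover have "faces_between {} F i \<inter> meeting (G - F) G i = {}"
    by (auto simp: faces_between_def meeting_def)
  ultimately show ?thesis by (simp add: card_Un_disjoint)
qed

lemma meeting_empty [simp]: "meeting {} G i = {}"
  by (auto simp: meeting_def)

text \<open>This is the bound \<open>\<phi>\<close> for a face \<open>G\<close> of dimension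
  \<open>rk G - 1\<close>, with the subtracted term moved to the other side. A facet of
  \<open>G\<close> missing \<open>m\<close> vertices has the parameter \<open>s - m + 1\<close> in
  place of \<open>s\<close>.\<close>

lemma card_faces_ge:
  assumes "G \<in> L" "Suc (card G) = rk G + s" "s = 1 \<or> s < rk G" "1 \<le> s"
  shows "(rk G choose Suc i) + ((rk G - 1) choose Suc i)
         \<le> card (faces_between {} G (Suc i)) + ((rk G - s) choose Suc i)"
  using assms
proof (induction "rk G" arbitrary: G s rule: less_induct)
  case less
  show ?case
  proof (cases "s = 1")
    case True
    then show ?thesis using card_between_ge[of "{}" G "Suc i"] less.prems empty_in rk_empty by auto
  next
    case False
    then have "rk G < card G" using less.prems by auto
    then obtain F where F: "F \<in> facets G" "2 \<le> card (G - F)"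
      using ex_non_pyramid_facet less.prems by blast
    note f = facetsD[OF F(1)]
    define m where "m = card (G - F)"
    have cG: "card G = card F + m"
      using f finite_face[OF less.prems(1)] unfolding m_def
      by (metis card_Diff_subset card_mono finite_subset le_add_diff_inverse)
    have "rk F \<le> card F" using rk_le_card f by auto
    then have m: "2 \<le> m" "m \<le> s" using F less.prems cG f unfolding m_def by auto
    define t where "t = s - m"
    have IH: "(rk F choose Suc i) + ((rk F - 1) choose Suc i)
         \<le> card (faces_between {} F (Suc i)) + ((rk F - Suc t) choose Suc i)"
      by (rule less.hyps) (use f cG less.prems m t_def in auto)
    have M: "(rk G choose Suc i) \<le> card (meeting (G - F) G (Suc i)) + ((rk G - m) choose Suc i)"
      using card_meeting_mono[of G "{}" "G - F" i] less.prems m m_def by auto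
    \<comment> \<open>The starting points \<open>rk G - s\<close> and \<open>rk F - Suc t\<close>
      differ by \<open>m - 2\<close>, so their order is the condition
      \<open>2 \<le> m\<close>.\<close>
    have C: "((rk F - Suc t) choose Suc i) + ((rk G - s + t) choose Suc i)
       \<le> ((rk F - Suc t + t) choose Suc i) + ((rk G - s) choose Suc i)"
      by (rule choose_convex) (use f m t_def less.prems False in auto)
    have e: "rk F - Suc t + t = rk F - 1" "rk G - s + t = rk G - m"
      using f m t_def less.prems False by auto
    show ?thesis
      using IH M C card_faces_split[OF F(1), of "Suc i"] f(3) unfolding e by simp
  qed
qed

section \<open>The case of equality\<close>

definition nbrs :: "'v \<Rightarrow> 'v set"
  where "nbrs v = {w\<in>V. w \<noteq> v \<and> {v, w} \<in> L \<and> rk {v, w} = 2}"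

definition apices :: "'v set"
  where "apices = {a\<in>V. V - {a} \<in> facets V}"

lemma nbrs_sym: "w \<in> nbrs v \<Longrightarrow> v \<in> nbrs w"
  using face_subset[of "{v, w}"] by (auto simp: nbrs_def insert_commute)

lemma finite_nbrs [simp]: "finite (nbrs v)"
  using finite_V by (auto simp: nbrs_def)

lemma edges_at: "faces_between {v} V 2 = (\<lambda>w. {v, w}) ` nbrs v" if "v \<in> V"
proof (intro equalityI subsetI)
  fix E assume "E \<in> faces_between {v} V 2"
  then have E: "E \<in> L" "v \<in> E" "E \<subseteq> V" "rk E = 2" by (auto simp: faces_between_def)
  then have "card E = 2" by (intro card_edge)
  then obtain x y where "E = {x, y}" "x \<noteq> y" by (auto simp: card_2_iff)
  then obtain w where "E = {v, w}" "w \<noteq> v" using E by auto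
  then show "E \<in> (\<lambda>w. {v, w}) ` nbrs v" using E by (auto simp: nbrs_def)
qed (use that in \<open>auto simp: faces_between_def nbrs_def\<close>)

lemma inj_on_edges_at: "inj_on (\<lambda>w. {v, w}) (nbrs v)"
  by (auto simp: inj_on_def nbrs_def doubleton_eq_iff)

lemma meeting_sing: "meeting {v} G i = faces_between {v} G i"
  by (auto simp: meeting_def faces_between_def)

end

text \<open>
  The vertex sets of the faces of the convex hull of \<open>A \<union> T \<union> {p, q}\<close> when these points have, up to
  scaling, exactly one affine dependency, which is positive on \<open>p\<close>, \<open>q\<close>, negative on \<open>T\<close> and zero
  on \<open>A\<close>.
\<close>

definition circuit_closed :: "'b set \<Rightarrow> 'b set \<Rightarrow> 'b \<Rightarrow> 'b \<Rightarrow> 'b set \<Rightarrow> bool"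
  where "circuit_closed A T p q W \<longleftrightarrow>
    W \<subseteq> insert p (insert q (A \<union> T)) \<and> (p \<in> W \<and> q \<in> W \<longleftrightarrow> T \<subseteq> W)"

text \<open>The number \<open>j\<close> is the dimension \<open>k\<close> and therefore appears as
  the rank \<open>Suc j\<close>. The bound \<open>1 \<le> j\<close> places this rank strictly above
  the vertices, and \<open>j + 2 \<le> d\<close> keeps it in the range where convexity is
  strict.\<close>

locale extremal_face_lattice = face_lattice +
  fixes d s j :: nat
  assumes rk_V: "rk V = Suc d" and card_V: "card V = d + s"
    and s: "2 \<le> s" "s \<le> d" and j: "1 \<le> j" "j + 2 \<le> d"
    and extremal: "card (faces_between {} V (Suc j)) + ((Suc d - s) choose Suc j)
                   = (Suc d choose Suc j) + (d choose Suc j)"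
begin

section \<open>Tight inequalities, simple vertices and adjacency\<close>

lemma card_facet: "card V = card F + card (V - F)" if "F \<in> facets V"
  using facetsD[OF that] finite_V
  by (metis card_Diff_subset card_mono finite_subset le_add_diff_inverse)

text \<open>The three inequalities behind \<open>card_faces_ge\<close> add up to the assumed
  equality, so each is tight. Convexity is tight only if the starting points coincide
  (\<open>m = 2\<close>) or the shift \<open>t\<close> vanishes (\<open>m = s\<close>).\<close>

lemma facet_equality:
  assumes F: "F \<in> facets V" "2 \<le> card (V - F)"
  shows "card (V - F) = 2 \<or> card (V - F) = s"
    and "card (V - F) \<le> s"
    and "card (meeting (V - F) V (Suc j)) + ((Suc d - card (V - F)) choose Suc j) = Suc d choose Suc j"
proof -
  note f = facetsD[OF F(1)]
  define m where "m = card (V - F)"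
  have cF: "card F + m = d + s" and rF: "rk F = d"
    using card_facet[OF F(1)] card_V rk_V f(3) m_def by simp_all
  then have m: "2 \<le> m" "m \<le> s" using rk_le_card[OF f(1)] F(2) m_def by auto
  define t where "t = s - m"
  have 1: "(d choose Suc j) + ((d - 1) choose Suc j)
         \<le> card (faces_between {} F (Suc j)) + ((d - Suc t) choose Suc j)"
  proof -
    have "Suc (card F) = rk F + Suc t" "Suc t = 1 \<or> Suc t < rk F" "1 \<le> Suc t"
      using cF rF m s t_def by auto
    from card_faces_ge[OF f(1) this, of j] show ?thesis by (simp only: rF)
  qed
  have 2: "(Suc d choose Suc j) \<le> card (meeting (V - F) V (Suc j)) + ((Suc d - m) choose Suc j)"
    using card_meeting_mono[of V "{}" "V - F" j] V_in m s rk_V m_def by simp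
  have e: "d - Suc t + t = d - 1" "Suc d - s + t = Suc d - m" "Suc d - s \<le> d - Suc t"
    using m t_def s by auto
  have 3: "((d - Suc t) choose Suc j) + ((Suc d - m) choose Suc j)
       \<le> ((d - 1) choose Suc j) + ((Suc d - s) choose Suc j)"
    using choose_convex[OF e(3), of "Suc j" t] unfolding e .
  note sp = card_faces_split[OF F(1), of "Suc j"]
  show "card (V - F) \<le> s" using m m_def by simp
  show "card (meeting (V - F) V (Suc j)) + ((Suc d - card (V - F)) choose Suc j) = Suc d choose Suc j"
    using 1 2 3 sp extremal unfolding m_def[symmetric] by linarith
  show "card (V - F) = 2 \<or> card (V - F) = s"
  proof (rule ccontr)
    assume "\<not> ?thesis"
    then have ne: "m \<noteq> 2" "m \<noteq> s" by (auto simp: m_def)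
    have "((d - Suc t) choose Suc j) + ((Suc d - s + t) choose Suc j)
       < ((d - Suc t + t) choose Suc j) + ((Suc d - s) choose Suc j)"
      by (rule choose_strict_convex) (use ne m t_def s j in auto)
    then show False using 1 2 sp extremal unfolding e by linarith
  qed
qed

text \<open>Monotonicity squeezes the value for \<open>S\<close> between those for \<open>{}\<close>
  and \<open>V - F\<close>, which agree.\<close>

lemma meeting_equality:
  assumes F: "F \<in> facets V" "2 \<le> card (V - F)" and S: "S \<subseteq> V - F"
  shows "card (meeting S V (Suc j)) + ((Suc d - card S) choose Suc j) = Suc d choose Suc j"
proof -
  have fin: "finite (V - F)" using finite_V by auto
  have m: "card (V - F) \<le> s" using facet_equality[OF F] by simp
  have cS: "card S \<le> card (V - F)" using S fin by (rule card_mono[rotated])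
  have "card (meeting S V (Suc j)) + ((Suc d - card S) choose Suc j) \<le> Suc d choose Suc j"
    using card_meeting_mono[of V S "V - F" j] facet_equality(3)[OF F] V_in S rk_V m s by simp
  moreover have "Suc d choose Suc j \<le> card (meeting S V (Suc j)) + ((Suc d - card S) choose Suc j)"
    using card_meeting_mono[of V "{}" S j] V_in S rk_V m s cS by auto
  ultimately show ?thesis by linarith
qed

text \<open>The number \<open>d choose j\<close> is the least possible one. The usual meaning of
  simple, \<open>d\<close> edges and \<open>d\<close> facets at \<open>v\<close>, is derived from
  this count in a single dimension.\<close>

definition simple :: "'a \<Rightarrow> bool"
  where "simple v \<longleftrightarrow> v \<in> V \<and> card (faces_between {v} V (Suc j)) = d choose j"

lemma simple_if_outside:
  assumes "F \<in> facets V" "2 \<le> card (V - F)" "v \<in> V - F"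
  shows "simple v"
  using meeting_equality[OF assms(1,2), of "{v}"] assms(3)
  by (auto simp: simple_def meeting_sing)

text \<open>The interval from \<open>{v}\<close> to \<open>V\<close> is extremal at rank
  \<open>Suc j\<close>; its atoms are the edges at \<open>v\<close>, so the matching of atoms and
  coatoms becomes one of neighbours and facets.\<close>

lemma simpleD:
  assumes "simple v"
  shows "v \<in> V" "card (nbrs v) = d" "card {F\<in>facets V. v \<in> F} = d"
    and "\<And>F. F \<in> facets V \<Longrightarrow> v \<in> F \<Longrightarrow> \<exists>!w. w \<in> nbrs v \<and> w \<notin> F"
    and "\<And>w. w \<in> nbrs v \<Longrightarrow> \<exists>!F. F \<in> facets V \<and> v \<in> F \<and> w \<notin> F"
proof -
  show v: "v \<in> V" using assms by (simp add: simple_def)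
  have eq: "card (faces_between {v} V (Suc j)) = (rk V - rk {v}) choose (Suc j - rk {v})"
    using assms v by (simp add: simple_def rk_sing rk_V)
  have r: "rk {v} < Suc j" "Suc j < rk V" using v j by (simp_all add: rk_sing rk_V)
  note h = sing_in[OF v] V_in
  have 2: "Suc (rk {v}) = 2" using rk_sing[OF v] by simp
  have "card (faces_between {v} V 2) = d"
    using extremal_interval_card[OF h _ r eq] v unfolding 2 by (simp add: rk_V rk_sing)
  moreover have "card (faces_between {v} V 2) = card {F\<in>facets V. v \<in> F}"
    using extremal_interval_card_eq[OF h _ r eq] v unfolding 2 by simp
  ultimately show "card (nbrs v) = d" "card {F\<in>facets V. v \<in> F} = d"
    using edges_at[OF v] card_image[OF inj_on_edges_at, of v] by simp_all
  show "\<exists>!w. w \<in> nbrs v \<and> w \<notin> F" if F: "F \<in> facets V" "v \<in> F" for F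
  proof -
    have "\<exists>!B. B \<in> faces_between {v} V 2 \<and> \<not> B \<subseteq> F"
      using extremal_interval_aux(1)[OF h r eq F(1)] F(2) unfolding 2 by simp
    then obtain B where B: "B \<in> faces_between {v} V 2" "\<not> B \<subseteq> F"
      and u: "\<And>C. C \<in> faces_between {v} V 2 \<Longrightarrow> \<not> C \<subseteq> F \<Longrightarrow> C = B" by blast
    obtain w where w: "w \<in> nbrs v" "B = {v, w}" using B(1) edges_at[OF v] by auto
    show ?thesis
    proof (rule ex1I[of _ w])
      show "w \<in> nbrs v \<and> w \<notin> F" using w B F by auto
      fix w' assume w': "w' \<in> nbrs v \<and> w' \<notin> F"
      then have "{v, w'} = {v, w}" using u[of "{v, w'}"] w edges_at[OF v] by auto
      then show "w' = w" by (auto simp: doubleton_eq_iff)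
    qed
  qed
  show "\<exists>!F. F \<in> facets V \<and> v \<in> F \<and> w \<notin> F" if w: "w \<in> nbrs v" for w
  proof -
    have "{v, w} \<in> faces_between {v} V (Suc (rk {v}))" unfolding 2 using edges_at[OF v] w by auto
    from extremal_interval_coatom_unique[OF h r eq this] show ?thesis
      by (rule back_subst[of Ex1]) auto
  qed
qed

text \<open>Equality for \<open>{u}\<close> and for \<open>{u, v}\<close> leaves exactly
  \<open>(d - 1) choose j\<close> faces of rank \<open>Suc j\<close> through \<open>v\<close> that
  avoid \<open>u\<close>. A facet \<open>H\<close> through \<open>v\<close> avoiding
  \<open>u\<close> already contains that many.\<close>

lemma nbrs_if_outside:
  assumes F: "F \<in> facets V" "2 \<le> card (V - F)" and uv: "u \<in> V - F" "v \<in> V - F" "u \<noteq> v"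
  shows "u \<in> nbrs v"
proof -
  have sv: "simple v" using simple_if_outside F uv by blast
  note h = sing_in[of v] V_in
  have v: "v \<in> V" "u \<in> V" using uv by auto
  obtain H where H: "H \<in> facets V" "v \<in> H" "u \<notin> H"
    using ex_facet_avoiding[of "{v}" V u] h uv by auto
  obtain w where w: "w \<in> nbrs v" "w \<notin> H" using simpleD(4)[OF sv H(1,2)] by blast
  have rH: "rk H = d" "H \<in> L" "H \<subseteq> V" using facetsD[OF H(1)] rk_V by auto
  obtain e where e: "d = Suc e" using s by (cases d) auto
  have "card (meeting {u} V (Suc j)) = d choose j"
    using meeting_equality[OF F, of "{u}"] uv by auto
  moreover have "card (meeting {u, v} V (Suc j)) = (d choose j) + (e choose j)"
    using meeting_equality[OF F, of "{u, v}"] uv e by auto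
  moreover have "meeting {u, v} V (Suc j) = meeting {u} V (Suc j) \<union> {K\<in>faces_between {v} V (Suc j). u \<notin> K}"
    by (auto simp: meeting_def faces_between_def)
  moreover have "card (meeting {u} V (Suc j) \<union> {K\<in>faces_between {v} V (Suc j). u \<notin> K})
      = card (meeting {u} V (Suc j)) + card {K\<in>faces_between {v} V (Suc j). u \<notin> K}"
    by (rule card_Un_disjoint) (auto simp: meeting_def finite_L)
  ultimately have c: "card {K\<in>faces_between {v} V (Suc j). u \<notin> K} = e choose j" by simp
  have "faces_between {v} H (Suc j) \<subseteq> {K\<in>faces_between {v} V (Suc j). u \<notin> K}"
    using H rH by (auto simp: faces_between_def)
  moreover have "e choose j \<le> card (faces_between {v} H (Suc j))"
    using card_between_ge[of "{v}" H "Suc j"] h v H rH e by (simp add: rk_sing)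
  ultimately have all: "faces_between {v} H (Suc j) = {K\<in>faces_between {v} V (Suc j). u \<notin> K}"
    using c by (intro card_seteq) auto
  \<comment> \<open>All \<open>(j+1)\<close>-faces through \<open>v\<close> avoiding \<open>u\<close> lie in \<open>H\<close>, so \<open>H\<close> is the only such facet; as \<open>v\<close> is
    simple, the other facets through \<open>v\<close> intersect in an edge, which therefore contains \<open>u\<close>.\<close>
  have un: "u \<in> K" if K: "K \<in> facets V" "v \<in> K" "K \<noteq> H" for K
  proof (rule ccontr)
    assume u: "u \<notin> K"
    have k: "K \<in> L" "K \<subseteq> V" "rk K = d" using facetsD[OF K(1)] rk_V by auto
    have "\<not> K \<subseteq> H" using facets_eqI K H by blast
    then obtain R where R: "R \<in> facets K" "H \<inter> K \<subseteq> R"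
      using ex_facet[of "H \<inter> K" K] Int_in rH k by blast
    \<comment> \<open>\<open>B\<close> is an edge at \<open>v\<close> in \<open>K\<close> but not in
      \<open>H\<close>. A face of rank \<open>Suc j\<close> between \<open>B\<close> and
      \<open>K\<close> avoids \<open>u\<close>, so it would have to lie in \<open>H\<close>.\<close>
    obtain B where B: "B \<in> faces_between {v} K (Suc (rk {v}))" "\<not> B \<subseteq> R"
      using ex_atom_outside_facet[of "{v}" K R] h v k R K H by auto
    then have b: "B \<in> L" "v \<in> B" "B \<subseteq> K" "rk B = 2" using v by (auto simp: faces_between_def rk_sing)
    obtain M where "M \<in> faces_between B K (Suc j)"
      using ex_between[of B K "Suc j"] b k j by auto
    then have M: "B \<subseteq> M" "M \<subseteq> K" "M \<in> faces_between {v} V (Suc j)"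
      using b k by (auto simp: faces_between_def)
    then have "M \<in> faces_between {v} H (Suc j)" using all u by auto
    then have "M \<subseteq> H" by (auto simp: faces_between_def)
    then show False using M B R by blast
  qed
  have "u = w"
  proof (rule ccontr)
    assume "u \<noteq> w"
    have "{v, w} \<in> L" "u \<notin> {v, w}" using w uv \<open>u \<noteq> w\<close> by (auto simp: nbrs_def)
    then obtain K where K: "K \<in> facets V" "{v, w} \<subseteq> K" "u \<notin> K"
      using ex_facet_avoiding[of "{v, w}" V u] face_subset V_in v by blast
    then show False using un[of K] w by auto
  qed
  then show ?thesis using w by simp
qed

end

text \<open>Here \<open>\<alpha>\<close> and \<open>\<beta>\<close> stand for the numbers of facet
  complements of size \<open>2\<close> and \<open>s\<close>, and the equation counts pairs of such a
  set and one of the \<open>2 * s\<close> non-apices outside it. Reduction modulo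
  \<open>s - 1\<close>, after halving if \<open>\<beta> = 0\<close>, excludes
  \<open>\<beta> < 2\<close>.\<close>

lemma prism_arith:
  fixes s \<alpha> \<beta> :: nat
  assumes "3 \<le> s" "\<beta> \<le> 2" "\<alpha> * (2 * s - 2) + \<beta> * s = 2 * s * s"
  shows "\<beta> = 2" "\<alpha> = s"
proof -
  obtain t where t: "s = Suc t" "2 \<le> t" using assms(1) by (cases s) auto
  have eq: "2 * (\<alpha> * t) + \<beta> * Suc t = 2 * (t * t) + 4 * t + 2" using assms(3) t by (simp add: algebra_simps)
  consider "\<beta> = 0" | "\<beta> = 1" | "\<beta> = 2" using assms(2) by linarith
  then have "\<beta> = 2"
  proof cases
    case 1
    then have "t * \<alpha> = t * (t + 2) + 1" using eq by (simp add: algebra_simps)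
    then have "t dvd 1" by (metis dvd_add_right_iff dvd_triv_left)
    then show ?thesis using t by simp
  next
    case 2
    then have "t * (2 * \<alpha> + 1) = t * (2 * t + 4) + 1" using eq by (simp add: algebra_simps)
    then have "t dvd 1" by (metis dvd_add_right_iff dvd_triv_left)
    then show ?thesis using t by simp
  qed
  moreover from this have "t * \<alpha> = t * Suc t" using eq by (simp add: algebra_simps)
  then have "\<alpha> = s" using t(2) unfolding t(1) by (simp only: mult_cancel1) auto
  ultimately show "\<beta> = 2" "\<alpha> = s" by auto
qed

lemma sum_card_swap:
  assumes "finite N" "finite \<O>" "\<And>v. v \<in> N \<Longrightarrow> card {S\<in>\<O>. P v S} = c"
  shows "(\<Sum>S\<in>\<O>. card {v\<in>N. P v S}) = c * card N"
proof -
  have "(\<Sum>S\<in>\<O>. card {v\<in>N. P v S}) = (\<Sum>S\<in>\<O>. \<Sum>v\<in>N. if P v S then 1 else 0)"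
    using assms by (simp add: sum.If_cases Int_def)
  also have "\<dots> = (\<Sum>v\<in>N. \<Sum>S\<in>\<O>. if P v S then 1 else 0)" by (rule sum.swap)
  also have "\<dots> = (\<Sum>v\<in>N. card {S\<in>\<O>. P v S})"
    using assms by (simp add: sum.If_cases Int_def)
  also have "\<dots> = c * card N" using assms by simp
  finally show ?thesis .
qed

text \<open>Each point lies in its block and in exactly one further set, a pair with one point in
  each block; so the pairs form a perfect matching.\<close>

lemma matching_if_two_blocks:
  assumes fin: "finite \<O>" and XY: "X \<in> \<O>" "Y \<in> \<O>" "X \<inter> Y = {}" "X \<noteq> Y"
    and sub: "\<And>S. S \<in> \<O> \<Longrightarrow> S \<subseteq> X \<union> Y"
    and two: "\<And>v. v \<in> X \<union> Y \<Longrightarrow> card {S\<in>\<O>. v \<in> S} = 2"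
    and pairs: "\<And>S. S \<in> \<O> \<Longrightarrow> S \<noteq> X \<Longrightarrow> S \<noteq> Y \<Longrightarrow> card S = 2 \<and> \<not> S \<subseteq> X \<and> \<not> S \<subseteq> Y"
  shows "\<exists>g. bij_betw g X Y \<and> \<O> = {X, Y} \<union> (\<lambda>x. {x, g x}) ` X"
proof -
  have ex1: "\<exists>!S. S \<in> \<O> \<and> v \<in> S \<and> S \<noteq> X \<and> S \<noteq> Y" if v: "v \<in> X \<union> Y" for v
  proof -
    obtain Z where Z: "Z \<in> {X, Y}" "v \<in> Z" using v by auto
    define M where "M = {S\<in>\<O>. v \<in> S}"
    have M: "S \<in> M \<longleftrightarrow> S \<in> \<O> \<and> v \<in> S" for S by (simp add: M_def)
    have "Z \<in> M" using Z XY M by auto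
    moreover obtain A B where AB: "M = {A, B}" "A \<noteq> B"
      using two[OF v] unfolding M_def[symmetric] by (auto simp: card_2_iff)
    ultimately obtain A' where A': "M = {Z, A'}" "A' \<noteq> Z" by (metis insertE insert_commute singletonD)
    have "A' \<in> M" using A' by simp
    then have n: "A' \<noteq> X" "A' \<noteq> Y" using A'(2) Z XY(3) M by auto
    show ?thesis
    proof (rule ex1I[of _ A'])
      show "A' \<in> \<O> \<and> v \<in> A' \<and> A' \<noteq> X \<and> A' \<noteq> Y" using n \<open>A' \<in> M\<close> M by simp
      fix S assume S: "S \<in> \<O> \<and> v \<in> S \<and> S \<noteq> X \<and> S \<noteq> Y"
      then have "S \<in> {Z, A'}" using M A'(1) by blast
      then show "S = A'" using S Z by blast
    qed
  qed
  have uniq: "S = S'" if "v \<in> X \<union> Y" "S \<in> \<O>" "v \<in> S" "S \<noteq> X" "S \<noteq> Y"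
    "S' \<in> \<O>" "v \<in> S'" "S' \<noteq> X" "S' \<noteq> Y" for v S S'
    using ex1[OF that(1)] that(2-) by (elim ex1E) metis
  have pair: "\<exists>x\<in>X. \<exists>y\<in>Y. S = {x, y}" if S: "S \<in> \<O>" "S \<noteq> X" "S \<noteq> Y" for S
  proof -
    obtain a b where ab: "S = {a, b}" using pairs[OF S] by (auto simp: card_2_iff)
    then have "a \<in> X \<and> b \<in> Y \<or> a \<in> Y \<and> b \<in> X" using pairs[OF S] sub[OF S(1)] by auto
    then show ?thesis using ab by auto
  qed
  have "\<exists>y. {x, y} \<in> \<O> \<and> y \<in> Y" if x: "x \<in> X" for x
  proof -
    obtain S where S: "S \<in> \<O>" "x \<in> S" "S \<noteq> X" "S \<noteq> Y" using ex1[of x] x by blast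
    obtain x' y where "x' \<in> X" "y \<in> Y" "S = {x', y}" using pair[of S] S by blast
    then show ?thesis using S x XY by auto
  qed
  then obtain g where g: "\<And>x. x \<in> X \<Longrightarrow> {x, g x} \<in> \<O> \<and> g x \<in> Y" by metis
  have gn: "{x, g x} \<noteq> X" "{x, g x} \<noteq> Y" if "x \<in> X" for x using g[OF that] that XY by auto
  have eq: "S = {x, g x}" if "S \<in> \<O>" "S \<noteq> X" "S \<noteq> Y" "x \<in> S" "x \<in> X" for S x
    by (rule uniq[of x]) (use g[of x] gn[of x] that in simp_all)
  have "inj_on g X"
  proof (rule inj_onI)
    fix x x' assume x: "x \<in> X" "x' \<in> X" "g x = g x'"
    have "{x, g x} = {x', g x'}"
      by (rule uniq[of "g x"]) (use g[of x] g[of x'] gn[of x] gn[of x'] x in simp_all)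
    then show "x = x'" using x g XY by (auto simp: doubleton_eq_iff)
  qed
  moreover have "g ` X = Y"
  proof (intro equalityI subsetI)
    fix y assume y: "y \<in> Y"
    then obtain S where S: "S \<in> \<O>" "y \<in> S" "S \<noteq> X" "S \<noteq> Y" using ex1[of y] by blast
    obtain x y' where xy: "x \<in> X" "y' \<in> Y" "S = {x, y'}" using pair[of S] S by blast
    then have "S = {x, g x}" using eq[of S x] S by auto
    then show "y \<in> g ` X" using S y xy XY by auto
  qed (use g in auto)
  moreover have "\<O> = {X, Y} \<union> (\<lambda>x. {x, g x}) ` X"
  proof (intro equalityI subsetI)
    fix S assume S: "S \<in> \<O>"
    show "S \<in> {X, Y} \<union> (\<lambda>x. {x, g x}) ` X"
    proof (cases "S = X \<or> S = Y")
      case False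
      then obtain x y where "x \<in> X" "S = {x, y}" using pair[of S] S by blast
      then show ?thesis using eq[of S x] S False by auto
    qed auto
  qed (use g XY in auto)
  ultimately show ?thesis by (auto simp: bij_betw_def)
qed

section \<open>Complements of facets and the structure of an extremal lattice\<close>

context extremal_face_lattice begin

text \<open>Despite the name, complements of facets over which the polytope is a pyramid are excluded.\<close>

definition cofacets :: "'a set set"
  where "cofacets = {V - G |G. G \<in> facets V \<and> 2 \<le> card (V - G)}"

lemma facet_outside_sing:
  assumes "F \<in> facets V" "\<not> 2 \<le> card (V - F)" "v \<in> V - F"
  shows "F = V - {v}"
proof -
  have "card (V - F) \<le> Suc 0" using assms by simp
  then have "V - F = {v}" using assms(3) finite_V card_le_Suc0_iff_eq[of "V - F"] by blast
  then show ?thesis using facetsD[OF assms(1)] by blast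
qed

lemma facet_outside_nonempty:
  assumes "F \<in> facets V" obtains v where "v \<in> V - F"
  using facetsD[OF assms] by (metis Diff_eq_empty_iff ex_in_conv n_not_Suc_n subset_antisym)

lemma apices_subset: "apices \<subseteq> V"
  by (auto simp: apices_def)

lemma finite_apices: "finite apices"
  using apices_subset finite_V finite_subset by blast

text \<open>A facet missing \<open>v\<close> and nothing else would be \<open>V - {v}\<close> and
  make \<open>v\<close> an apex.\<close>

lemma simple_if_not_apex:
  assumes "v \<in> V - apices" shows "simple v"
proof -
  obtain F where F: "F \<in> facets V" "v \<notin> F"
    using ex_facet_avoiding[of "{}" V v] empty_in V_in assms by auto
  then have "2 \<le> card (V - F)"
    using facet_outside_sing[of F v] assms by (auto simp: apices_def)
  then show ?thesis using simple_if_outside F assms by blast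
qed

lemma apices_subset_facet:
  assumes "G \<in> facets V" "2 \<le> card (V - G)" shows "apices \<subseteq> G"
proof
  fix a assume a: "a \<in> apices"
  then have aV: "V - {a} \<in> facets V" "a \<in> V" by (auto simp: apices_def)
  show "a \<in> G"
  proof (rule ccontr)
    assume "a \<notin> G"
    then have "G = V - {a}" using facets_eqI[of G V "V - {a}"] assms aV facetsD[of G V] by blast
    moreover have "V - (V - {a}) = {a}" using aV by auto
    ultimately show False using assms by simp
  qed
qed

text \<open>The facet \<open>V - {a}\<close> omits a neighbour of the simple vertex
  \<open>v\<close>, and \<open>a\<close> is all it omits.\<close>

lemma apex_nbr:
  assumes "v \<in> V - apices" "a \<in> apices" shows "a \<in> nbrs v"
proof -
  have "V - {a} \<in> facets V" "v \<in> V - {a}" using assms by (auto simp: apices_def)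
  then obtain w where "w \<in> nbrs v" "w \<notin> V - {a}" using simpleD(4)[OF simple_if_not_apex[OF assms(1)]] by blast
  then show ?thesis by (auto simp: nbrs_def)
qed

lemma cofacets_subset: "S \<in> cofacets \<Longrightarrow> S \<subseteq> V - apices"
  using apices_subset_facet by (auto simp: cofacets_def)

lemma finite_cofacets: "finite cofacets"
  by (rule finite_subset[of _ "Pow V"]) (use finite_V in \<open>auto simp: cofacets_def\<close>)

lemma cofacet_card: "S \<in> cofacets \<Longrightarrow> card S = 2 \<or> card S = s"
  using facet_equality(1) by (auto simp: cofacets_def)

lemma cofacet_clique: "S \<in> cofacets \<Longrightarrow> u \<in> S \<Longrightarrow> v \<in> S \<Longrightarrow> u \<noteq> v \<Longrightarrow> u \<in> nbrs v"
  using nbrs_if_outside by (auto simp: cofacets_def)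

text \<open>\<open>w\<close> is a simple vertex on the facet whose complement is
  \<open>S\<close>.\<close>

lemma cofacet_unique_nbr:
  assumes "S \<in> cofacets" "w \<in> V - apices - S" shows "\<exists>!u. u \<in> nbrs w \<and> u \<in> S"
proof -
  obtain G where G: "S = V - G" "G \<in> facets V" "2 \<le> card (V - G)" using assms by (auto simp: cofacets_def)
  have "\<exists>!u. u \<in> nbrs w \<and> u \<notin> G"
    using simpleD(4)[OF simple_if_not_apex G(2)] assms G by auto
  moreover have "nbrs w \<subseteq> V" by (auto simp: nbrs_def)
  ultimately show ?thesis unfolding G(1) by blast
qed

lemma cofacet_nbr_eq:
  assumes "S \<in> cofacets" "w \<in> V - apices - S" "u \<in> nbrs w" "u \<in> S" "v \<in> nbrs w" "v \<in> S"
  shows "u = v"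
  using cofacet_unique_nbr[OF assms(1,2)] assms(3-) by (elim ex1E) metis

text \<open>The \<open>d\<close> neighbours of \<open>u\<close> are the rest of the clique
  \<open>S\<close>, all the apices, and the vertices counted here.\<close>

lemma cofacet_out_degree:
  assumes "S \<in> cofacets" "u \<in> S"
  shows "card (nbrs u \<inter> (V - apices - S)) + card S + card apices = Suc d"
proof -
  have S: "S \<subseteq> V - apices" using cofacets_subset assms by blast
  then have fS: "finite S" using finite_V finite_subset by blast
  have u: "u \<in> V - apices" using S assms by blast
  have "nbrs u = (S - {u}) \<union> (apices \<union> (nbrs u \<inter> (V - apices - S)))"
    using cofacet_clique[OF assms(1)] apex_nbr[OF u] assms(2) S by (auto simp: nbrs_def)
  moreover have "card ((S - {u}) \<union> (apices \<union> (nbrs u \<inter> (V - apices - S))))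
      = card (S - {u}) + (card apices + card (nbrs u \<inter> (V - apices - S)))"
    using S fS finite_apices by (subst card_Un_disjoint | force)+
  moreover have "card (nbrs u) = d" using simpleD(2)[OF simple_if_not_apex[OF u]] .
  moreover have "card S = Suc (card (S - {u}))" using card_Suc_Diff1[OF fS assms(2)] by simp
  ultimately show ?thesis by simp
qed

lemma card_nonapices: "card (V - apices) + card apices = d + s"
  using card_V finite_V apices_subset card_Diff_subset[OF finite_apices apices_subset] card_mono[OF finite_V apices_subset]
  by simp

lemma ex_cofacet: "\<exists>S. S \<in> cofacets"
proof -
  have "rk V < card V" using rk_V card_V s by simp
  then show ?thesis using ex_non_pyramid_facet[OF V_in] by (auto simp: cofacets_def)
qed

text \<open>Every vertex of \<open>S\<close> has the same number \<open>c\<close> of non-apex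
  neighbours outside \<open>S\<close>, and every non-apex outside \<open>S\<close> has one neighbour
  in \<open>S\<close>. Comparing this count with the degree gives
  \<open>(card S - 1) * c = s - 1\<close>, so \<open>card S\<close> and \<open>c + 1\<close> are
  \<open>2\<close> and \<open>s\<close> in some order and their sum is known.\<close>

lemma card_apices: "card apices + s = d"
proof -
  obtain S where S: "S \<in> cofacets" using ex_cofacet by blast
  have SN: "S \<subseteq> V - apices" using cofacets_subset[OF S] .
  then have fS: "finite S" using finite_V finite_subset by blast
  have ne: "card S \<ge> 2" using cofacet_card[OF S] s by auto
  then obtain u0 where u0: "u0 \<in> S" by (metis card.empty ex_in_conv not_numeral_le_zero)
  define c where "c = card (nbrs u0 \<inter> (V - apices - S))"
  have c: "c + card S + card apices = Suc d" using cofacet_out_degree[OF S u0] c_def by simp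
  have cc: "card (nbrs u \<inter> (V - apices - S)) = c" if "u \<in> S" for u
    using cofacet_out_degree[OF S that] c by simp
  have "\<exists>u\<in>S. w \<in> nbrs u" if "w \<in> V - apices - S" for w
    using ex1_implies_ex[OF cofacet_unique_nbr[OF S that]] nbrs_sym by blast
  then have "V - apices - S = (\<Union>u\<in>S. nbrs u \<inter> (V - apices - S))" by blast
  moreover have "card (\<Union>u\<in>S. nbrs u \<inter> (V - apices - S)) = (\<Sum>u\<in>S. card (nbrs u \<inter> (V - apices - S)))"
  proof (rule card_UN_disjoint)
    show "\<forall>u\<in>S. \<forall>v\<in>S. u \<noteq> v \<longrightarrow> (nbrs u \<inter> (V - apices - S)) \<inter> (nbrs v \<inter> (V - apices - S)) = {}"
      using cofacet_nbr_eq[OF S] nbrs_sym by (meson IntE disjoint_iff)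
  qed (use fS in auto)
  ultimately have "card (V - apices - S) = card S * c" using cc by simp
  moreover have "card (V - apices - S) = card (V - apices) - card S"
    using SN fS by (rule card_Diff_subset[rotated])
  moreover have "card S \<le> card (V - apices)" using SN finite_V by (intro card_mono) auto
  ultimately have e: "card S * c + card S + card apices = d + s" using card_nonapices by linarith
  then have e2: "card S * c + 1 = c + s" using c by linarith
  from cofacet_card[OF S] have "c + card S = Suc s"
  proof
    assume "card S = 2" then show ?thesis using e2 by simp
  next
    assume cs: "card S = s"
    obtain t where t: "s = Suc t" "1 \<le> t" using s by (cases s) auto
    have "t * c = t" using e2 cs t by simp
    then show ?thesis using cs t by simp
  qed
  then show ?thesis using c by linarith
qed

lemma card_nonapices_eq: "card (V - apices) = 2 * s"
  using card_nonapices card_apices by linarith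

text \<open>Of the \<open>d\<close> facets through the simple vertex \<open>v\<close>, those of the
  form \<open>V - {a}\<close> account for \<open>d - s\<close>.\<close>

lemma card_cofacets_avoiding:
  assumes v: "v \<in> V - apices" shows "card {S\<in>cofacets. v \<notin> S} = s"
proof -
  let ?G = "{F\<in>facets V. v \<in> F \<and> 2 \<le> card (V - F)}"
  have "{F\<in>facets V. v \<in> F} = (\<lambda>a. V - {a}) ` apices \<union> ?G"
  proof (intro equalityI subsetI)
    fix F assume F: "F \<in> {F\<in>facets V. v \<in> F}"
    then obtain a where a: "a \<in> V - F" using facet_outside_nonempty[of F] by blast
    show "F \<in> (\<lambda>a. V - {a}) ` apices \<union> ?G"
    proof (cases "2 \<le> card (V - F)")
      case False
      then have "F = V - {a}" using facet_outside_sing F a by blast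
      then show ?thesis using F a by (auto simp: apices_def)
    qed (use F in auto)
  qed (use v in \<open>auto simp: apices_def\<close>)
  moreover have "card ((\<lambda>a. V - {a}) ` apices \<union> ?G) = card ((\<lambda>a. V - {a}) ` apices) + card ?G"
  proof (rule card_Un_disjoint)
    have "\<not> 2 \<le> card (V - (V - {a}))" for a
    proof -
      have "card (V - (V - {a})) \<le> card {a}" by (rule card_mono) auto
      then show ?thesis by simp
    qed
    then show "(\<lambda>a. V - {a}) ` apices \<inter> ?G = {}" by auto
  qed (use finite_apices in auto)
  moreover have "card ((\<lambda>a. V - {a}) ` apices) = card apices"
    using apices_subset by (intro card_image) (auto simp: inj_on_def)
  moreover have "card {F\<in>facets V. v \<in> F} = d" using simpleD(3)[OF simple_if_not_apex[OF v]] .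
  ultimately have "card ?G = s" using card_apices by simp
  moreover have "bij_betw (\<lambda>F. V - F) ?G {S\<in>cofacets. v \<notin> S}"
  proof (rule bij_betw_imageI)
    show "inj_on (\<lambda>F. V - F) ?G" using facetsD(2) by (auto simp: inj_on_def)
    show "(\<lambda>F. V - F) ` ?G = {S\<in>cofacets. v \<notin> S}" using v by (auto simp: cofacets_def)
  qed
  ultimately show ?thesis using bij_betw_same_card by fastforce
qed

lemma sum_card_cofacets: "(\<Sum>S\<in>cofacets. card (V - apices - S)) = s * (2 * s)"
proof -
  have "(\<Sum>S\<in>cofacets. card {v\<in>V - apices. v \<notin> S}) = s * card (V - apices)"
    by (rule sum_card_swap) (use finite_V finite_cofacets card_cofacets_avoiding in auto)
  moreover have "{v\<in>V - apices. v \<notin> S} = V - apices - S" for S by auto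
  ultimately show ?thesis using card_nonapices_eq by simp
qed

lemma cofacet_finite: "S \<in> cofacets \<Longrightarrow> finite S"
  using cofacets_subset finite_V finite_subset by (metis finite_Diff)

lemma card_cofacet_compl: "S \<in> cofacets \<Longrightarrow> card (V - apices - S) = 2 * s - card S"
  using card_Diff_subset[OF cofacet_finite cofacets_subset] card_nonapices_eq by simp

text \<open>A common vertex \<open>v\<close> has only one non-apex neighbour outside
  \<open>X\<close>, so the clique \<open>X'\<close> has at most one vertex outside \<open>X\<close>
  and at least two inside. The vertex outside then has two neighbours in \<open>X\<close>, against
  \<open>cofacet_unique_nbr\<close>.\<close>

lemma large_cofacets_disjoint:
  assumes s3: "3 \<le> s" and X: "X \<in> cofacets" "card X = s" and X': "X' \<in> cofacets" "card X' = s"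
    and ne: "X \<noteq> X'"
  shows "X \<inter> X' = {}"
proof (rule ccontr)
  assume "X \<inter> X' \<noteq> {}"
  then obtain v where v: "v \<in> X" "v \<in> X'" by auto
  have fin: "finite X" "finite X'" using X X' cofacet_finite by auto
  have "\<not> X' \<subseteq> X" using card_subset_eq[of X X'] fin X X' ne by auto
  then obtain z where z: "z \<in> X'" "z \<notin> X" by auto
  have zN: "z \<in> V - apices - X" using z cofacets_subset[OF X'(1)] by blast
  have one: "card (nbrs v \<inter> (V - apices - X)) = 1"
    using cofacet_out_degree[OF X(1) v(1)] X card_apices by linarith
  have sub: "X' - X \<subseteq> nbrs v \<inter> (V - apices - X)"
    using cofacet_clique[OF X'(1)] v cofacets_subset[OF X'(1)] by blast
  have "card (X' - X) \<le> 1" using card_mono[OF _ sub] one by simp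
  moreover have "card X' = card (X' - X) + card (X' \<inter> X)"
    using fin by (metis card_Diff_subset_Int card_mono finite_Int inf_le1 le_add_diff_inverse2)
  ultimately have "2 \<le> card (X' \<inter> X)" using X' s3 by linarith
  then obtain v' where v': "v' \<in> X' \<inter> X" "v' \<noteq> v"
    by (metis card_2_iff' obtain_subset_with_card_n subsetD)
  have "v \<in> nbrs z" "v' \<in> nbrs z" using cofacet_clique[OF X'(1)] z v v' by blast+
  then show False using cofacet_nbr_eq[OF X(1) zN] v v' by blast
qed

text \<open>For \<open>s = 2\<close> the two possible sizes coincide, and incidence counts alone
  must produce the complementary pair. For \<open>3 \<le> s\<close> the large sets are disjoint in a
  set of \<open>2 * s\<close> points, so there are at most two, and \<open>prism_arith\<close> gives
  the exact numbers.\<close>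

lemma ex_complementary_cofacets:
  "\<exists>X\<in>cofacets. \<exists>Y\<in>cofacets. X \<inter> Y = {} \<and> X \<union> Y = V - apices \<and> card X = s \<and> card Y = s
     \<and> card cofacets = s + 2
     \<and> (\<forall>S\<in>cofacets. S \<noteq> X \<longrightarrow> S \<noteq> Y \<longrightarrow> card S = 2 \<and> \<not> S \<subseteq> X \<and> \<not> S \<subseteq> Y)"
proof (cases "s = 2")
  case True
  have c2: "card S = 2" if "S \<in> cofacets" for S using cofacet_card[OF that] True by simp
  have "(\<Sum>S\<in>cofacets. card (V - apices - S)) = 2 * card cofacets"
    using card_cofacet_compl c2 True by simp
  then have c4: "card cofacets = 4" using sum_card_cofacets True by simp
  have two: "card {S\<in>cofacets. v \<in> S} = 2" if "v \<in> V - apices" for v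
  proof -
    have "card cofacets = card {S\<in>cofacets. v \<in> S} + card {S\<in>cofacets. v \<notin> S}"
      using finite_cofacets by (subst card_Un_disjoint[symmetric]) (auto intro!: arg_cong[of _ _ card])
    then show ?thesis using card_cofacets_avoiding[OF that] True c4 by simp
  qed
  obtain X where X: "X \<in> cofacets" using ex_cofacet by blast
  obtain a b where ab: "X = {a, b}" "a \<noteq> b" using c2[OF X] by (auto simp: card_2_iff)
  have abN: "a \<in> V - apices" "b \<in> V - apices" using cofacets_subset[OF X] ab by auto
  let ?A = "{S\<in>cofacets. a \<in> S}" and ?B = "{S\<in>cofacets. b \<in> S}"
  have "X \<in> ?A \<inter> ?B" using X ab by auto
  then have "1 \<le> card (?A \<inter> ?B)" using finite_cofacets by (auto simp: Suc_le_eq card_gt_0_iff)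
  moreover have "card ?A + card ?B = card (?A \<union> ?B) + card (?A \<inter> ?B)"
    using finite_cofacets by (intro card_Un_Int) auto
  \<comment> \<open>Two sets contain \<open>a\<close> and two contain \<open>b\<close>, and
    \<open>X\<close> is counted twice: at most three of the four sets, so some \<open>Y\<close>
    contains neither.\<close>
  ultimately have "card (?A \<union> ?B) < card cofacets" using two abN c4 by simp
  then have "?A \<union> ?B \<noteq> cofacets" by (metis less_irrefl)
  moreover have "?A \<union> ?B \<subseteq> cofacets" by blast
  ultimately obtain Y where Y: "Y \<in> cofacets" "a \<notin> Y" "b \<notin> Y" by blast
  have sub: "X \<union> Y \<subseteq> V - apices" using cofacets_subset X Y by blast
  have disj: "X \<inter> Y = {}" using ab Y by auto
  have "card (X \<union> Y) = 4" using disj c2 X Y cofacet_finite by (simp add: card_Un_disjoint)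
  then have un: "X \<union> Y = V - apices"
    using sub card_nonapices_eq True finite_V by (intro card_subset_eq) auto
  have "\<not> S \<subseteq> Z" if "S \<in> cofacets" "Z \<in> cofacets" "S \<noteq> Z" for S Z
    using card_subset_eq[of Z S] that c2 cofacet_finite by auto
  then show ?thesis using X Y disj un c2 True c4 by (intro bexI[of _ X] bexI[of _ Y]) auto
next
  case False
  then have s3: "3 \<le> s" using s by simp
  define P where "P = {S\<in>cofacets. card S = 2}"
  define Q where "Q = {S\<in>cofacets. card S = s}"
  have mP: "S \<in> P \<longleftrightarrow> S \<in> cofacets \<and> card S = 2" for S by (simp add: P_def)
  have mQ: "S \<in> Q \<longleftrightarrow> S \<in> cofacets \<and> card S = s" for S by (simp add: Q_def)
  have PQ: "cofacets = P \<union> Q" "P \<inter> Q = {}" using cofacet_card s3 mP mQ by auto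
  have fin: "finite P" "finite Q" using finite_cofacets by (simp_all add: P_def Q_def)
  have "(\<Sum>S\<in>cofacets. card (V - apices - S))
      = (\<Sum>S\<in>P. card (V - apices - S)) + (\<Sum>S\<in>Q. card (V - apices - S))"
    unfolding PQ(1) by (rule sum.union_disjoint[OF fin PQ(2)])
  also have "\<dots> = card P * (2 * s - 2) + card Q * s"
    using card_cofacet_compl mP mQ by simp
  finally have eq: "card P * (2 * s - 2) + card Q * s = 2 * s * s" using sum_card_cofacets by simp
  have "card (\<Union>Q) = card Q * s"
  proof -
    have "card (\<Union>Q) = (\<Sum>S\<in>Q. card S)"
      using large_cofacets_disjoint[OF s3] cofacet_finite mQ
      by (intro card_Union_disjoint) (auto simp: pairwise_def disjnt_def)
    then show ?thesis using mQ by simp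
  qed
  moreover have "card (\<Union>Q) \<le> card (V - apices)"
    using cofacets_subset finite_V mQ by (intro card_mono) auto
  ultimately have "card Q * s \<le> 2 * s" using card_nonapices_eq by simp
  then have "card Q \<le> 2" using s3 by simp
  from prism_arith[OF s3 this eq] have Q2: "card Q = 2" and Ps: "card P = s" by auto
  then obtain X Y where XY: "Q = {X, Y}" "X \<noteq> Y" by (auto simp: card_2_iff)
  then have X: "X \<in> cofacets" "card X = s" and Y: "Y \<in> cofacets" "card Y = s" using mQ by blast+
  have disj: "X \<inter> Y = {}" using large_cofacets_disjoint[OF s3 X Y XY(2)] .
  have "card (X \<union> Y) = 2 * s" using disj X Y cofacet_finite by (simp add: card_Un_disjoint)
  moreover have "X \<union> Y \<subseteq> V - apices" using cofacets_subset X Y by blast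
  ultimately have un: "X \<union> Y = V - apices"
    using card_nonapices_eq finite_V by (intro card_subset_eq) auto
  have nsub: "\<not> S \<subseteq> Z" if S: "S \<in> cofacets" "card S = 2" and Z: "Z \<in> cofacets" "card Z = s" for S Z
  proof
    assume "S \<subseteq> Z"
    obtain a b where ab: "S = {a, b}" "a \<noteq> b" using S by (auto simp: card_2_iff)
    have "S \<noteq> Z" using S Z s3 by auto
    \<comment> \<open>\<open>Z\<close> is a clique, so a further vertex of it is joined to both
      points of \<open>S\<close>, although it may have only one neighbour there.\<close>
    then obtain w where w: "w \<in> Z" "w \<notin> S" using \<open>S \<subseteq> Z\<close> by auto
    have "a \<in> nbrs w" "b \<in> nbrs w" using cofacet_clique[OF Z(1)] w ab \<open>S \<subseteq> Z\<close> by auto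
    moreover have "w \<in> V - apices - S" using w cofacets_subset[OF Z(1)] by auto
    ultimately show False using cofacet_nbr_eq[OF S(1)] ab by blast
  qed
  have "card cofacets = s + 2"
    unfolding PQ(1) using card_Un_disjoint[OF fin PQ(2)] Q2 Ps by simp
  moreover have "card S = 2" if "S \<in> cofacets" "S \<noteq> X" "S \<noteq> Y" for S
    using cofacet_card[OF that(1)] that XY mQ by blast
  ultimately show ?thesis using X Y disj un nsub by (intro bexI[of _ X] bexI[of _ Y]) auto
qed

text \<open>These are the facet complements of an iterated pyramid over a prism: \<open>X\<close>
  and \<open>Y\<close> are the vertex sets of the two bases, and \<open>g\<close> matches the ends
  of the lateral edges.\<close>

theorem facet_structure:
  obtains X Y g where "X \<inter> Y = {}" "X \<union> Y = V - apices" "card X = s" "bij_betw g X Y"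
    "facets V = (\<lambda>S. V - S) ` ((\<lambda>a. {a}) ` apices \<union> {X, Y} \<union> (\<lambda>x. {x, g x}) ` X)"
proof -
  obtain X Y where XY: "X \<in> cofacets" "Y \<in> cofacets" "X \<inter> Y = {}" "X \<union> Y = V - apices" "card X = s"
    and c: "card cofacets = s + 2"
    and pairs: "\<And>S. S \<in> cofacets \<Longrightarrow> S \<noteq> X \<Longrightarrow> S \<noteq> Y \<Longrightarrow> card S = 2 \<and> \<not> S \<subseteq> X \<and> \<not> S \<subseteq> Y"
  proof -
    obtain X Y where "X \<in> cofacets" "Y \<in> cofacets" and h: "X \<inter> Y = {} \<and> X \<union> Y = V - apices \<and> card X = s \<and> card Y = s
       \<and> card cofacets = s + 2
       \<and> (\<forall>S\<in>cofacets. S \<noteq> X \<longrightarrow> S \<noteq> Y \<longrightarrow> card S = 2 \<and> \<not> S \<subseteq> X \<and> \<not> S \<subseteq> Y)"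
      using ex_complementary_cofacets by (elim bexE)
    with that[of X Y] show ?thesis by (elim conjE) metis
  qed
  have two: "card {S\<in>cofacets. v \<in> S} = 2" if "v \<in> X \<union> Y" for v
  proof -
    have "card cofacets = card {S\<in>cofacets. v \<in> S} + card {S\<in>cofacets. v \<notin> S}"
      using finite_cofacets by (subst card_Un_disjoint[symmetric]) (auto intro!: arg_cong[of _ _ card])
    then show ?thesis using card_cofacets_avoiding[of v] that XY c by simp
  qed
  have "X \<noteq> {}" using XY s by auto
  then have "X \<noteq> Y" using XY by auto
  have sub: "S \<subseteq> X \<union> Y" if "S \<in> cofacets" for S using cofacets_subset[OF that] XY(4) by simp
  have "\<exists>g. bij_betw g X Y \<and> cofacets = {X, Y} \<union> (\<lambda>x. {x, g x}) ` X"
    by (rule matching_if_two_blocks[OF finite_cofacets XY(1-3) \<open>X \<noteq> Y\<close>]) (fact sub two pairs)+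
  then obtain g where g: "bij_betw g X Y" "cofacets = {X, Y} \<union> (\<lambda>x. {x, g x}) ` X"
    by (elim exE conjE)
  have "facets V = (\<lambda>S. V - S) ` ((\<lambda>a. {a}) ` apices \<union> cofacets)"
  proof (intro equalityI subsetI)
    fix F assume F: "F \<in> facets V"
    then obtain a where a: "a \<in> V - F" using facet_outside_nonempty[of F] by blast
    have FV: "F = V - (V - F)" using facetsD[OF F] by auto
    show "F \<in> (\<lambda>S. V - S) ` ((\<lambda>a. {a}) ` apices \<union> cofacets)"
    proof (cases "2 \<le> card (V - F)")
      case True
      then have "V - F \<in> cofacets" using F by (auto simp: cofacets_def)
      then show ?thesis using FV by blast
    next
      case False
      then have "F = V - {a}" using facet_outside_sing F a by blast
      then show ?thesis using F a by (auto simp: apices_def)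
    qed
  next
    fix F assume "F \<in> (\<lambda>S. V - S) ` ((\<lambda>a. {a}) ` apices \<union> cofacets)"
    then consider a where "a \<in> apices" "F = V - {a}" | G where "G \<in> facets V" "F = V - (V - G)"
      by (auto simp: cofacets_def)
    then show "F \<in> facets V"
    proof cases
      case 2
      then show ?thesis using facetsD(2)[of G V] by (simp add: double_diff)
    qed (auto simp: apices_def)
  qed
  then show ?thesis using that[OF XY(3,4,5) g(1)] g(2) by (simp add: Un_assoc)
qed

section \<open>The order-reversing bijection with the closed sets of a circuit\<close>

lemma compl_UN_in_L:
  assumes "finite I" "\<And>i. i \<in> I \<Longrightarrow> V - C i \<in> L"
  shows "V - (\<Union>i\<in>I. C i) \<in> L"
  using assms
proof (induction I rule: finite_induct)
  case empty
  then show ?case using V_in by simp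
next
  case (insert x I)
  then have "(V - C x) \<inter> (V - (\<Union>i\<in>I. C i)) \<in> L" by (intro Int_in) auto
  moreover have "(V - C x) \<inter> (V - (\<Union>i\<in>I. C i)) = V - (\<Union>i\<in>insert x I. C i)" by auto
  ultimately show ?case by simp
qed

text \<open>Each point of the circuit is assigned a facet, of which \<open>C\<close> gives the
  complement: \<open>A\<close> goes to the apices, \<open>T\<close> to the matched pairs,
  \<open>p\<close> and \<open>q\<close> to \<open>X\<close> and \<open>Y\<close>. Since the pairs
  have union \<open>X \<union> Y\<close>, a face lies in all facets of \<open>T\<close> exactly if
  it lies in those of \<open>p\<close> and \<open>q\<close>; this is closedness.\<close>

theorem ex_antiisomorphism:
  fixes A T :: "'b set" and p q :: 'b
  assumes fin: "finite A" "finite T" and card: "card A + s = d" "card T = s"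
    and disj: "A \<inter> T = {}" "p \<notin> A \<union> T" "q \<notin> A \<union> T" "p \<noteq> q"
  shows "\<exists>h. bij_betw h (Collect (circuit_closed A T p q)) L \<and>
     (\<forall>W W'. circuit_closed A T p q W \<longrightarrow> circuit_closed A T p q W' \<longrightarrow> (W \<subseteq> W' \<longleftrightarrow> h W' \<subseteq> h W))"
proof -
  obtain X Y g where XY: "X \<inter> Y = {}" "X \<union> Y = V - apices" "card X = s" and g: "bij_betw g X Y"
    and F: "facets V = (\<lambda>S. V - S) ` ((\<lambda>a. {a}) ` apices \<union> {X, Y} \<union> (\<lambda>x. {x, g x}) ` X)"
    by (rule facet_structure)
  have finX: "finite X" using XY(3) s by (metis card.infinite not_numeral_le_zero)
  obtain \<alpha> where \<alpha>: "bij_betw \<alpha> A apices"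
    using finite_same_card_bij[OF fin(1) finite_apices] card card_apices by auto
  obtain \<beta> where \<beta>: "bij_betw \<beta> T X"
    using finite_same_card_bij[OF fin(2) finX] card XY(3) by auto
  have \<alpha>A: "\<alpha> a \<in> apices" if "a \<in> A" for a using \<alpha> that by (auto simp: bij_betw_def)
  have \<beta>X: "\<beta> t \<in> X" if "t \<in> T" for t using \<beta> that by (auto simp: bij_betw_def)
  have gY: "g x \<in> Y" if "x \<in> X" for x using g that by (auto simp: bij_betw_def)
  have inj: "\<And>a b. a \<in> A \<Longrightarrow> b \<in> A \<Longrightarrow> \<alpha> a = \<alpha> b \<Longrightarrow> a = b"
     "\<And>a b. a \<in> T \<Longrightarrow> b \<in> T \<Longrightarrow> \<beta> a = \<beta> b \<Longrightarrow> a = b"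
     "\<And>a b. a \<in> X \<Longrightarrow> b \<in> X \<Longrightarrow> g a = g b \<Longrightarrow> a = b"
    using \<alpha> \<beta> g by (auto simp: bij_betw_def inj_on_def)
  define U where "U = insert p (insert q (A \<union> T))"
  have finU: "finite U" using fin by (simp add: U_def)
  define C where "C w = (if w \<in> A then {\<alpha> w} else if w \<in> T then {\<beta> w, g (\<beta> w)} else if w = p then X else Y)" for w
  have CA: "C a = {\<alpha> a}" if "a \<in> A" for a using that by (simp add: C_def)
  have CT: "C t = {\<beta> t, g (\<beta> t)}" if "t \<in> T" for t using that disj(1) by (auto simp: C_def)
  have Cp: "C p = X" and Cq: "C q = Y" using disj by (auto simp: C_def)
  have "C ` U = (\<lambda>a. {a}) ` apices \<union> {X, Y} \<union> (\<lambda>x. {x, g x}) ` X"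
  proof -
    have "C ` A = (\<lambda>a. {a}) ` \<alpha> ` A" "C ` T = (\<lambda>x. {x, g x}) ` \<beta> ` T"
      using CA CT by (auto simp: image_image)
    then show ?thesis using \<alpha> \<beta> Cp Cq by (auto simp: U_def image_Un bij_betw_def)
  qed
  with F have F': "facets V = (\<lambda>w. V - C w) ` U" by (simp add: image_image[symmetric])
  have CV: "C w \<subseteq> V" if "w \<in> U" for w
    using that \<alpha>A \<beta>X gY XY apices_subset unfolding U_def C_def by auto
  have UT: "(\<Union>t\<in>T. C t) = X \<union> Y"
  proof -
    have "(\<Union>t\<in>T. C t) = (\<Union>x\<in>\<beta> ` T. {x, g x})" using CT by auto
    also have "\<dots> = X \<union> g ` X" using \<beta> by (auto simp: bij_betw_def)
    finally show ?thesis using g by (simp add: bij_betw_def)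
  qed
  define h where "h W = V - (\<Union>w\<in>W. C w)" for W
  have cl: "circuit_closed A T p q W \<longleftrightarrow> W \<subseteq> U \<and> (p \<in> W \<and> q \<in> W \<longleftrightarrow> T \<subseteq> W)" for W
    by (simp add: circuit_closed_def U_def)
  \<comment> \<open>A closed set is determined by the union of its complements, because each
    \<open>w\<close> outside it keeps an uncovered point in \<open>C w\<close>. For \<open>t\<close>
    in \<open>T\<close> this is \<open>\<beta> t\<close> if \<open>p\<close> is absent and
    \<open>g (\<beta> t)\<close> if \<open>q\<close> is absent.\<close>
  have sep: "\<exists>v\<in>C w. \<forall>w'\<in>W. v \<notin> C w'"
    if W: "circuit_closed A T p q W" and w: "w \<in> U" "w \<notin> W" for W w
  proof -
    have WU: "W \<subseteq> U" using W cl by blast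
    have sepT: "\<forall>w'\<in>W. \<beta> t \<notin> C w'" if t: "t \<in> T" "t \<notin> W" and p: "p \<notin> W" for t
    proof
      fix w' assume "w' \<in> W"
      then have w': "w' \<in> U" "w' \<noteq> t" "w' \<noteq> p" using WU t p by auto
      have bt: "\<beta> t \<in> X" using \<beta>X t by simp
      consider "w' \<in> A" | "w' \<in> T" | "w' = q" using w' U_def by blast
      then show "\<beta> t \<notin> C w'"
      proof cases
        case 1 then show ?thesis using CA \<alpha>A[of w'] bt XY by auto
      next
        case 2 then show ?thesis using CT[OF 2] bt XY(1) gY[OF \<beta>X[OF 2]] inj(2)[OF t(1) 2] w' by auto
      next
        case 3 then show ?thesis using Cq bt XY by auto
      qed
    qed
    have sepT': "\<forall>w'\<in>W. g (\<beta> t) \<notin> C w'" if t: "t \<in> T" "t \<notin> W" and q: "q \<notin> W" for t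
    proof
      fix w' assume "w' \<in> W"
      then have w': "w' \<in> U" "w' \<noteq> t" "w' \<noteq> q" using WU t q by auto
      have bt: "\<beta> t \<in> X" "g (\<beta> t) \<in> Y" using \<beta>X gY t by auto
      consider "w' \<in> A" | "w' \<in> T" | "w' = p" using w' U_def by blast
      then show "g (\<beta> t) \<notin> C w'"
      proof cases
        case 1 then show ?thesis using CA \<alpha>A[of w'] bt XY by auto
      next
        case 2
        then have "\<beta> t \<noteq> \<beta> w'" using inj(2)[OF t(1) 2] w' by auto
        then have "g (\<beta> t) \<noteq> g (\<beta> w')" using inj(3)[OF bt(1) \<beta>X[OF 2]] by auto
        moreover have "g (\<beta> t) \<noteq> \<beta> w'" using bt \<beta>X[OF 2] XY(1) by auto
        ultimately show ?thesis using CT[OF 2] by auto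
      next
        case 3 then show ?thesis using Cp bt XY by auto
      qed
    qed
    consider "w \<in> A" | "w \<in> T" | "w = p" | "w = q" using w U_def by blast
    then show ?thesis
    proof cases
      case 1
      note wA = this
      have "\<alpha> w \<notin> C w'" if "w' \<in> W" for w'
      proof -
        have w': "w' \<in> U" "w' \<noteq> w" using WU that w by auto
        have aw: "\<alpha> w \<in> apices" using \<alpha>A 1 by simp
        then have nXY: "\<alpha> w \<notin> X" "\<alpha> w \<notin> Y" using XY(2) by auto
        consider "w' \<in> A" | "w' \<in> T" | "w' = p" | "w' = q" using w' U_def by blast
        then show ?thesis
        proof cases
          case 1 then show ?thesis using CA inj(1)[OF wA 1] w' by auto
        next
          case 2 then show ?thesis using CT[OF 2] nXY \<beta>X[OF 2] gY[OF \<beta>X[OF 2]] by auto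
        qed (use Cp Cq nXY in auto)
      qed
      then show ?thesis using CA[OF 1] by auto
    next
      case 2
      then have "\<not> T \<subseteq> W" using w by auto
      then have "p \<notin> W \<or> q \<notin> W" using W cl by blast
      then show ?thesis using sepT[OF 2 w(2)] sepT'[OF 2 w(2)] CT[OF 2] by auto
    next
      case 3
      then have "\<not> T \<subseteq> W" using W cl w by blast
      then obtain t where t: "t \<in> T" "t \<notin> W" by auto
      then show ?thesis using sepT[OF t] w 3 Cp \<beta>X by auto
    next
      case 4
      then have "\<not> T \<subseteq> W" using W cl w by blast
      then obtain t where t: "t \<in> T" "t \<notin> W" by auto
      then show ?thesis using sepT'[OF t] w 4 Cq \<beta>X gY by auto
    qed
  qed
  have anti: "W \<subseteq> W' \<longleftrightarrow> h W' \<subseteq> h W"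
    if W: "circuit_closed A T p q W" and W': "circuit_closed A T p q W'" for W W'
  proof
    assume "W \<subseteq> W'" then show "h W' \<subseteq> h W" by (auto simp: h_def)
  next
    assume sub: "h W' \<subseteq> h W"
    show "W \<subseteq> W'"
    proof (rule ccontr)
      assume "\<not> W \<subseteq> W'"
      then obtain w where w: "w \<in> W" "w \<notin> W'" by auto
      have "w \<in> U" using w W cl by blast
      then obtain v where v: "v \<in> C w" "\<forall>w'\<in>W'. v \<notin> C w'" using sep[OF W' _ w(2)] by blast
      then have "v \<in> h W'" using CV[OF \<open>w \<in> U\<close>] by (auto simp: h_def)
      then show False using sub v w by (auto simp: h_def)
    qed
  qed
  have "bij_betw h (Collect (circuit_closed A T p q)) L"
  proof (rule bij_betw_imageI)
    show "inj_on h (Collect (circuit_closed A T p q))"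
      by (rule inj_onI) (use anti in \<open>auto\<close>)
    show "h ` Collect (circuit_closed A T p q) = L"
    proof (intro equalityI subsetI)
      fix K assume "K \<in> h ` Collect (circuit_closed A T p q)"
      then obtain W where W: "W \<subseteq> U" "K = h W" using cl by blast
      have "V - C w \<in> L" if "w \<in> W" for w
        using F' facetsD(1)[of "V - C w" V] W that by blast
      then show "K \<in> L" unfolding W(2) h_def using finite_subset[OF W(1) finU] by (intro compl_UN_in_L)
    next
      fix K assume K: "K \<in> L"
      \<comment> \<open>\<open>W\<close> indexes all facets containing \<open>K\<close>, and a face
        is the intersection of these.\<close>
      define W where "W = {w\<in>U. K \<inter> C w = {}}"
      have "h W = K"
      proof (intro equalityI subsetI)
        fix v assume v: "v \<in> h W"
        show "v \<in> K"
        proof (rule ccontr)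
          assume "v \<notin> K"
          moreover have "v \<in> V" using v by (simp add: h_def)
          ultimately obtain H where H: "H \<in> facets V" "K \<subseteq> H" "v \<notin> H"
            using ex_facet_avoiding[OF K V_in face_subset[OF K]] by blast
          then obtain w where "w \<in> U" "H = V - C w" using F' by blast
          then show False using H v by (auto simp: h_def W_def)
        qed
      next
        fix v assume "v \<in> K"
        then show "v \<in> h W" using face_subset[OF K] by (auto simp: h_def W_def)
      qed
      moreover have "circuit_closed A T p q W"
      proof -
        have "p \<in> W \<and> q \<in> W \<longleftrightarrow> K \<inter> (X \<union> Y) = {}" by (auto simp: W_def U_def Cp Cq)
        moreover have "T \<subseteq> W \<longleftrightarrow> K \<inter> (\<Union>t\<in>T. C t) = {}" by (auto simp: W_def U_def)
        ultimately show ?thesis unfolding cl UT by (auto simp: W_def)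
      qed
      ultimately show "K \<in> h ` Collect (circuit_closed A T p q)" by blast
    qed
  qed
  with anti show ?thesis by blast
qed

end

section \<open>The face lattice of a polytope\<close>

definition verts :: "'a::euclidean_space set \<Rightarrow> 'a set"
  where "verts P = {v. v extreme_point_of P}"

definition face_sets :: "'a::euclidean_space set \<Rightarrow> 'a set set"
  where "face_sets P = (\<lambda>F. F \<inter> verts P) ` {F. F face_of P}"

text \<open>A face and its vertex set have the same affine dimension, so the vertex set suffices.
  The empty face has dimension \<open>-1\<close>, hence rank \<open>0\<close>.\<close>

definition face_rank :: "'a::euclidean_space set \<Rightarrow> nat"
  where "face_rank W = nat (aff_dim W + 1)"

lemma finite_verts: "polytope P \<Longrightarrow> finite (verts P)"
  unfolding verts_def by (simp add: finite_polyhedron_extreme_points polytope_imp_polyhedron)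

lemma verts_face: "F face_of P \<Longrightarrow> verts F = F \<inter> verts P"
  by (auto simp: verts_def extreme_point_of_face)

lemma polytope_eq_hull_verts: "polytope P \<Longrightarrow> P = convex hull (verts P)"
  unfolding verts_def by (simp add: Krein_Milman_Minkowski polytope_imp_compact polytope_imp_convex)

lemma face_eq_hull_verts:
  assumes "polytope P" "F face_of P" shows "F = convex hull (F \<inter> verts P)"
  using polytope_eq_hull_verts[OF face_of_polytope_polytope[OF assms]] verts_face[OF assms(2)] by simp

lemma face_subset_iff_verts:
  assumes "polytope P" "F face_of P" "G face_of P"
  shows "F \<subseteq> G \<longleftrightarrow> F \<inter> verts P \<subseteq> G \<inter> verts P"
proof
  assume "F \<inter> verts P \<subseteq> G \<inter> verts P"
  then have "convex hull (F \<inter> verts P) \<subseteq> convex hull (G \<inter> verts P)" by (rule hull_mono)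
  then show "F \<subseteq> G" using face_eq_hull_verts assms by metis
qed auto

lemma inj_on_Int_verts: "polytope P \<Longrightarrow> inj_on (\<lambda>F. F \<inter> verts P) {F. F face_of P}"
  by (rule inj_onI) (metis face_eq_hull_verts mem_Collect_eq)

lemma face_rank_Int_verts:
  assumes "polytope P" "F face_of P" shows "face_rank (F \<inter> verts P) = nat (aff_dim F + 1)"
  unfolding face_rank_def by (metis aff_dim_convex_hull assms face_eq_hull_verts)

text \<open>\<open>facet_of\<close> excludes the empty set, so the case of a point \<open>G\<close>,
  whose only proper face is \<open>{}\<close>, is treated by hand.\<close>

lemma facet_above_face:
  assumes P: "polytope G" and F: "F face_of G" "F \<noteq> G"
  shows "\<exists>H. H face_of G \<and> F \<subseteq> H \<and> aff_dim H = aff_dim G - 1"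
proof (cases "F = {}")
  case False
  then obtain H where "H facet_of G" "F \<subseteq> H"
    using face_of_polyhedron_subset_facet[OF polytope_imp_polyhedron[OF P] F(1)] F(2) by blast
  then show ?thesis by (auto simp: facet_of_def)
next
  case True
  show ?thesis
  proof (cases "aff_dim G = 0")
    case True
    then show ?thesis using \<open>F = {}\<close> by (intro exI[of _ "{}"]) auto
  next
    case False
    have "aff_dim G \<noteq> -1" using True F(2) by (metis aff_dim_empty)
    then have "0 < aff_dim G" using False aff_dim_geq[of G] by linarith
    then obtain H where "H facet_of G" using polytope_facet_exists[OF P] by blast
    then show ?thesis using True by (auto simp: facet_of_def)
  qed
qed

lemma card_verts_edge:
  assumes "polytope E" "aff_dim E = 1" shows "card (verts E) = 2"
proof -
  obtain n where n: "n simplex E"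
    using polytope_lowdim_imp_simplex[OF assms(1)] assms(2) by auto
  then obtain C where C: "\<not> affine_dependent C" "int (card C) = n + 1" "E = convex hull C"
    by (auto simp: simplex_def)
  have "n = 1" using aff_dim_simplex[OF n] assms by simp
  moreover have "verts E = C"
    using extreme_point_of_convex_hull_affine_independent[OF C(1)] C(3) by (auto simp: verts_def)
  ultimately show ?thesis using C by simp
qed

text \<open>A nonempty proper face is the intersection of the facets containing it, so
  \<open>H\<close> is not the only facet of \<open>G\<close> above \<open>F\<close>. For
  \<open>F = {}\<close> the claim is that an edge has a second vertex.\<close>

lemma ex_other_face_between:
  assumes P: "polytope G" and H: "H face_of G" and F: "F face_of H"
    and "aff_dim H = aff_dim F + 1" "aff_dim G = aff_dim F + 2"
  shows "\<exists>H'. H' face_of G \<and> H' \<noteq> H \<and> F \<subseteq> H' \<and> F \<noteq> H' \<and> H' \<noteq> G"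
proof (cases "F = {}")
  case True
  then have dims: "aff_dim H = 0" "aff_dim G = 1" using assms by auto
  then obtain v where v: "H = {v}" by (auto simp: aff_dim_eq_0)
  then obtain w where w: "w \<in> verts G" "w \<noteq> v"
    using card_verts_edge[OF P dims(2)] by (metis card_2_iff insert_iff)
  have "{w} face_of G" using w by (simp add: verts_def face_of_singleton)
  moreover have "{w} \<noteq> G" using dims by auto
  ultimately show ?thesis using w v True by (intro exI[of _ "{w}"]) auto
next
  case False
  have FG: "F face_of G" using F H face_of_trans by blast
  have "F \<noteq> G" "F \<noteq> H" using assms by auto
  then have eq: "F = \<Inter>{f. f facet_of G \<and> F \<subseteq> f}"
    using face_of_polyhedron[OF polytope_imp_polyhedron[OF P] FG False] by blast
  have "\<exists>f. f facet_of G \<and> F \<subseteq> f \<and> f \<noteq> H"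
  proof (rule ccontr)
    assume "\<not> ?thesis"
    then have "{f. f facet_of G \<and> F \<subseteq> f} \<subseteq> {H}" by auto
    then have "H \<subseteq> \<Inter>{f. f facet_of G \<and> F \<subseteq> f}" by auto
    then have "H \<subseteq> F" using eq by blast
    then show False using \<open>F \<noteq> H\<close> face_of_imp_subset[OF F] by auto
  qed
  then obtain f where f: "f facet_of G" "F \<subseteq> f" "f \<noteq> H" by blast
  moreover have "aff_dim f = aff_dim G - 1" using f by (simp add: facet_of_def)
  then have "f \<noteq> F" "f \<noteq> G" using assms by auto
  ultimately show ?thesis using facet_of_imp_face_of by blast
qed

theorem polytope_face_lattice:
  fixes P :: "'a::euclidean_space set"
  assumes P: "polytope P"
  shows "face_lattice (verts P) (face_sets P) face_rank"
proof -
  have faceE: "\<exists>F. F face_of P \<and> W = F \<inter> verts P \<and> face_rank W = nat (aff_dim F + 1)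
      \<and> polytope F" if "W \<in> face_sets P" for W
    using that face_rank_Int_verts[OF P] face_of_polytope_polytope[OF P] by (auto simp: face_sets_def)
  have faceI: "F face_of P \<Longrightarrow> F \<inter> verts P \<in> face_sets P" for F by (auto simp: face_sets_def)
  have psub: "F \<subseteq> G \<and> F \<noteq> G \<and> F face_of G"
    if "F face_of P" "G face_of P" "F \<inter> verts P \<subset> G \<inter> verts P" for F G
    using that face_subset_iff_verts[OF P] face_of_face by blast
  have psubI: "F \<inter> verts P \<subset> G \<inter> verts P" if "F face_of P" "G face_of P" "F \<subseteq> G" "F \<noteq> G" for F G
    using that face_subset_iff_verts[OF P] inj_onD[OF inj_on_Int_verts[OF P], of F G] by blast
  show ?thesis
  proof
    show "finite (verts P)" by (rule finite_verts[OF P])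
    show "F \<subseteq> verts P" if "F \<in> face_sets P" for F using that by (auto simp: face_sets_def)
    show "verts P \<in> face_sets P"
    proof -
      have "P \<inter> verts P = verts P" by (auto simp: verts_def extreme_point_of_def)
      then show ?thesis using faceI[of P] P face_of_refl polytope_imp_convex by metis
    qed
    show "{} \<in> face_sets P" using faceI[of "{}"] by simp
    show "F \<inter> G \<in> face_sets P" if h: "F \<in> face_sets P" "G \<in> face_sets P" for F G
    proof -
      obtain F' G' where "F' face_of P" "F = F' \<inter> verts P" "G' face_of P" "G = G' \<inter> verts P"
        using h by (auto simp: face_sets_def)
      then show ?thesis using faceI[OF face_of_Int[of F' P G']] by (simp add: Int_ac)
    qed
    show "{v} \<in> face_sets P" if "v \<in> verts P" for v
      using that faceI[of "{v}"] by (simp add: verts_def face_of_singleton)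
    show "face_rank {} = 0" by (simp add: face_rank_def)
    show "face_rank {v} = 1" if "v \<in> verts P" for v by (simp add: face_rank_def)
    show "face_rank F < face_rank G" if h: "F \<in> face_sets P" "G \<in> face_sets P" "F \<subset> G" for F G
    proof -
      obtain F' G' where F': "F' face_of P" "F = F' \<inter> verts P" "face_rank F = nat (aff_dim F' + 1)"
        and G': "G' face_of P" "G = G' \<inter> verts P" "face_rank G = nat (aff_dim G' + 1)" "polytope G'"
        using faceE[OF h(1)] faceE[OF h(2)] by blast
      have "aff_dim F' < aff_dim G'"
        using face_of_aff_dim_lt[of G' F'] psub[of F' G'] F' G' h polytope_imp_convex by blast
      then show ?thesis using F'(3) G'(3) aff_dim_geq[of F'] by linarith
    qed
    show "\<exists>H\<in>face_sets P. F \<subseteq> H \<and> H \<subset> G \<and> face_rank G = Suc (face_rank H)"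
      if h: "F \<in> face_sets P" "G \<in> face_sets P" "F \<subset> G" for F G
    proof -
      obtain F' G' where F': "F' face_of P" "F = F' \<inter> verts P"
        and G': "G' face_of P" "G = G' \<inter> verts P" "face_rank G = nat (aff_dim G' + 1)" "polytope G'"
        using faceE[OF h(1)] faceE[OF h(2)] by blast
      have "F' face_of G'" "F' \<noteq> G'" using psub[of F' G'] F' G' h by auto
      then obtain H where H: "H face_of G'" "F' \<subseteq> H" "aff_dim H = aff_dim G' - 1"
        using facet_above_face[OF G'(4)] by blast
      have HP: "H face_of P" using H G' face_of_trans by blast
      have "H \<noteq> G'" using H by auto
      then have "H \<inter> verts P \<subset> G" using psubI[OF HP G'(1) face_of_imp_subset[OF H(1)]] G' by simp
      moreover have "face_rank G = Suc (face_rank (H \<inter> verts P))"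
        using face_rank_Int_verts[OF P HP] G'(3) H(3) aff_dim_geq[of H] by linarith
      moreover have "F \<subseteq> H \<inter> verts P" using H(2) F'(2) by blast
      ultimately show ?thesis using faceI[OF HP] by (intro bexI[of _ "H \<inter> verts P"] conjI)
    qed
    show "\<exists>H'\<in>face_sets P. H' \<noteq> H \<and> F \<subset> H' \<and> H' \<subset> G"
      if h: "F \<in> face_sets P" "H \<in> face_sets P" "G \<in> face_sets P" "F \<subset> H" "H \<subset> G"
        "face_rank G = face_rank F + 2" for F H G
    proof -
      obtain F' H' G' where F': "F' face_of P" "F = F' \<inter> verts P" "face_rank F = nat (aff_dim F' + 1)"
        and H': "H' face_of P" "H = H' \<inter> verts P" "polytope H'"
        and G': "G' face_of P" "G = G' \<inter> verts P" "face_rank G = nat (aff_dim G' + 1)" "polytope G'"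
        using faceE[OF h(1)] faceE[OF h(2)] faceE[OF h(3)] by blast
      have 1: "F' face_of H'" "F' \<noteq> H'" "H' face_of G'" "H' \<noteq> G'"
        using psub[of F' H'] psub[of H' G'] F' H' G' h by auto
      have "aff_dim F' < aff_dim H'" "aff_dim H' < aff_dim G'"
        using face_of_aff_dim_lt 1 H' G' polytope_imp_convex by blast+
      then have "aff_dim H' = aff_dim F' + 1" "aff_dim G' = aff_dim F' + 2"
        using F'(3) G'(3) h(6) aff_dim_geq[of F'] by linarith+
      then obtain K where K: "K face_of G'" "K \<noteq> H'" "F' \<subseteq> K" "F' \<noteq> K" "K \<noteq> G'"
        using ex_other_face_between[OF G'(4) 1(3) 1(1)] by blast
      have KP: "K face_of P" using K G' face_of_trans by blast
      have "K \<inter> verts P \<noteq> H"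
        using inj_onD[OF inj_on_Int_verts[OF P], of K H'] KP H' K by auto
      moreover have "F \<subset> K \<inter> verts P" using psubI[OF F'(1) KP] K F' by simp
      moreover have "K \<inter> verts P \<subset> G" using psubI[OF KP G'(1) face_of_imp_subset[OF K(1)]] K G' by simp
      ultimately show ?thesis using faceI[OF KP] by (intro bexI[of _ "K \<inter> verts P"] conjI)
    qed
    show "card E = 2" if h: "E \<in> face_sets P" "face_rank E = 2" for E
    proof -
      obtain F where F: "F face_of P" "E = F \<inter> verts P" "face_rank E = nat (aff_dim F + 1)" "polytope F"
        using faceE[OF h(1)] by blast
      then show ?thesis using card_verts_edge[OF F(4)] verts_face[OF F(1)] h(2) by simp
    qed
  qed
qed

lemma card_rank_faces:
  assumes "polytope P"
  shows "card {W\<in>face_sets P. face_rank W = Suc k} = face_count k P"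
proof -
  have "{W\<in>face_sets P. face_rank W = Suc k} = (\<lambda>F. F \<inter> verts P) ` {F. F face_of P \<and> aff_dim F = int k}"
  proof (intro equalityI subsetI)
    fix W assume "W \<in> {W\<in>face_sets P. face_rank W = Suc k}"
    then obtain F where F: "F face_of P" "W = F \<inter> verts P" "face_rank W = Suc k"
      by (auto simp: face_sets_def)
    then have "aff_dim F = int k" using face_rank_Int_verts[OF assms F(1)] by simp
    then show "W \<in> (\<lambda>F. F \<inter> verts P) ` {F. F face_of P \<and> aff_dim F = int k}" using F by blast
  next
    fix W assume "W \<in> (\<lambda>F. F \<inter> verts P) ` {F. F face_of P \<and> aff_dim F = int k}"
    then obtain F where F: "F face_of P" "W = F \<inter> verts P" "aff_dim F = int k" by blast
    then have "face_rank W = Suc k" using face_rank_Int_verts[OF assms F(1)] by simp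
    then show "W \<in> {W\<in>face_sets P. face_rank W = Suc k}" using F by (auto simp: face_sets_def)
  qed
  moreover have "inj_on (\<lambda>F. F \<inter> verts P) {F. F face_of P \<and> aff_dim F = int k}"
    by (rule inj_on_subset[OF inj_on_Int_verts[OF assms]]) auto
  ultimately show ?thesis by (simp add: card_image face_count_def)
qed

section \<open>Iterated pyramids over a bipyramid\<close>

text \<open>The segment from \<open>p\<close> to \<open>q\<close> crosses the relative interior of
  the simplex on \<open>T\<close>, and \<open>A\<close> holds the apices of the pyramids. All points
  but \<open>q\<close> are affinely independent, which makes the dependency unique up to
  scaling.\<close>

locale circuit_config =
  fixes A T :: "'a::euclidean_space set" and p q :: 'a and l :: real and m :: "'a \<Rightarrow> real"
  assumes disj: "A \<inter> T = {}" "p \<notin> A \<union> T" "q \<notin> A \<union> T" "p \<noteq> q"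
    and indep: "\<not> affine_dependent (insert p (A \<union> T))"
    and l: "0 < l" "l < 1"
    and m: "\<And>t. t \<in> T \<Longrightarrow> 0 < m t" "sum m T = 1"
    and circuit: "l *\<^sub>R p + (1 - l) *\<^sub>R q = (\<Sum>t\<in>T. m t *\<^sub>R t)"
begin

abbreviation U where "U \<equiv> insert p (insert q (A \<union> T))"

lemma finite_AT: "finite A" "finite T"
  using aff_independent_finite[OF indep] by auto

lemma sum_U: "sum f U = f q + sum f (insert p (A \<union> T))" for f :: "'a \<Rightarrow> 'b::comm_monoid_add"
proof -
  have "U = insert q (insert p (A \<union> T))" by auto
  then show ?thesis using disj finite_AT by simp
qed

lemma sum_B: "sum f (insert p (A \<union> T)) = f p + (sum f A + sum f T)" for f :: "'a \<Rightarrow> 'b::comm_monoid_add"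
  using disj finite_AT by (simp add: sum.union_disjoint)

definition dep :: "'a \<Rightarrow> real"
  where "dep v = (if v = p then l else if v = q then 1 - l else if v \<in> T then - m v else 0)"

lemma dep_simps: "dep p = l" "dep q = 1 - l" "t \<in> T \<Longrightarrow> dep t = - m t" "a \<in> A \<Longrightarrow> dep a = 0"
  using disj by (auto simp: dep_def)

lemma sum_dep: "sum dep U = 0" "(\<Sum>v\<in>U. dep v *\<^sub>R v) = 0"
proof -
  have "sum dep T = - sum m T" by (simp add: dep_simps sum_negf)
  then show "sum dep U = 0" using m by (simp add: sum_U sum_B dep_simps)
  have "(\<Sum>v\<in>T. dep v *\<^sub>R v) = - (\<Sum>t\<in>T. m t *\<^sub>R t)" by (simp add: dep_simps sum_negf)
  then show "(\<Sum>v\<in>U. dep v *\<^sub>R v) = 0" using circuit[symmetric] by (simp add: sum_U sum_B dep_simps)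
qed

text \<open>Subtracting the multiple of \<open>dep\<close> that cancels the coefficient of
  \<open>q\<close> leaves a dependency among affinely independent points.\<close>

lemma dependency_unique:
  assumes "sum \<delta> U = 0" "(\<Sum>v\<in>U. \<delta> v *\<^sub>R v) = 0"
  shows "\<exists>c. \<forall>v\<in>U. \<delta> v = c * dep v"
proof (intro exI ballI)
  define c where "c = \<delta> q / (1 - l)"
  define \<epsilon> where "\<epsilon> v = \<delta> v - c * dep v" for v
  let ?B = "insert p (A \<union> T)"
  have q: "\<epsilon> q = 0" using l by (simp add: \<epsilon>_def c_def dep_simps)
  have "sum \<epsilon> U = sum \<delta> U - c * sum dep U"
    by (simp only: \<epsilon>_def[abs_def] sum_subtractf sum_distrib_left)
  then have "sum \<epsilon> U = 0" using assms(1) sum_dep(1) by simp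
  then have 1: "sum \<epsilon> ?B = 0" using q unfolding sum_U by simp
  have "(\<Sum>v\<in>U. \<epsilon> v *\<^sub>R v) = (\<Sum>v\<in>U. \<delta> v *\<^sub>R v) - c *\<^sub>R (\<Sum>v\<in>U. dep v *\<^sub>R v)"
    by (simp only: \<epsilon>_def scaleR_diff_left sum_subtractf scaleR_sum_right scaleR_scaleR)
  then have "(\<Sum>v\<in>U. \<epsilon> v *\<^sub>R v) = 0" using assms(2) sum_dep(2) by simp
  then have 2: "(\<Sum>v\<in>?B. \<epsilon> v *\<^sub>R v) = 0" using q unfolding sum_U by simp
  have "\<forall>v\<in>?B. \<epsilon> v = 0"
    using indep affine_dependent_explicit_finite[of ?B] 1 2 finite_AT by blast
  then show "\<delta> v = c * dep v" if "v \<in> U" for v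
    using that q by (auto simp: \<epsilon>_def)
qed

text \<open>This is the criterion for \<open>convex hull W\<close> to be a face. A common point
  gives a dependency \<open>c * dep\<close> that is not positive outside \<open>W\<close>, so
  \<open>W\<close> contains \<open>p\<close> and \<open>q\<close> or all of \<open>T\<close>,
  depending on the sign of \<open>c\<close>. By closedness it contains both, and only points of
  \<open>A\<close>, where \<open>dep\<close> vanishes, remain outside.\<close>

lemma closed_hulls_disjoint:
  assumes W: "circuit_closed A T p q W"
  shows "affine hull W \<inter> convex hull (U - W) = {}"
proof (rule ccontr)
  assume "affine hull W \<inter> convex hull (U - W) \<noteq> {}"
  then obtain y where y: "y \<in> affine hull W" "y \<in> convex hull (U - W)" by auto
  have WU: "W \<subseteq> U" using W by (simp add: circuit_closed_def)
  have finU: "finite U" using finite_AT by simp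
  have fin: "finite W" "finite (U - W)" using finite_subset[OF WU finU] finU by auto
  obtain \<alpha> where \<alpha>: "sum \<alpha> W = 1" "(\<Sum>v\<in>W. \<alpha> v *\<^sub>R v) = y"
    using y(1) affine_hull_finite[OF fin(1)] by auto
  obtain \<gamma> where \<gamma>: "\<forall>v\<in>U - W. 0 \<le> \<gamma> v" "sum \<gamma> (U - W) = 1" "(\<Sum>v\<in>U - W. \<gamma> v *\<^sub>R v) = y"
    using y(2) convex_hull_finite[OF fin(2)] by auto
  define \<delta> where "\<delta> v = (if v \<in> W then \<alpha> v else - \<gamma> v)" for v
  have split: "sum f U = sum f W + sum f (U - W)" for f :: "'a \<Rightarrow> 'c::comm_monoid_add"
    using sum.subset_diff[OF WU finU] by (simp add: add.commute)
  have "sum \<delta> W = sum \<alpha> W" "sum \<delta> (U - W) = - sum \<gamma> (U - W)"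
    by (auto simp: \<delta>_def sum_negf[symmetric] intro!: sum.cong)
  then have 1: "sum \<delta> U = 0" using \<alpha> \<gamma> split[of \<delta>] by simp
  have "(\<Sum>v\<in>W. \<delta> v *\<^sub>R v) = (\<Sum>v\<in>W. \<alpha> v *\<^sub>R v)"
       "(\<Sum>v\<in>U - W. \<delta> v *\<^sub>R v) = - (\<Sum>v\<in>U - W. \<gamma> v *\<^sub>R v)"
    by (auto simp: \<delta>_def sum_negf[symmetric] intro!: sum.cong)
  then have 2: "(\<Sum>v\<in>U. \<delta> v *\<^sub>R v) = 0" using \<alpha> \<gamma> split[of "\<lambda>v. \<delta> v *\<^sub>R v"] by simp
  obtain c where c: "\<And>v. v \<in> U \<Longrightarrow> \<delta> v = c * dep v" using dependency_unique[OF 1 2] by blast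
  have out: "\<gamma> v = - c * dep v" if "v \<in> U - W" for v using c[of v] that by (simp add: \<delta>_def)
  have "\<exists>u\<in>U - W. \<gamma> u \<noteq> 0" using \<gamma>(2) by (metis sum.neutral zero_neq_one)
  then obtain u where u: "u \<in> U - W" "c * dep u \<noteq> 0" using out by auto
  have np: "v \<in> U - W \<Longrightarrow> c * dep v \<le> 0" for v using \<gamma>(1) out by fastforce
  have pq: "p \<in> W \<and> q \<in> W \<longleftrightarrow> T \<subseteq> W" using W by (simp add: circuit_closed_def)
  have "p \<in> W \<and> q \<in> W"
  proof (cases "0 < c")
    case True
    then have "0 < c * dep p" "0 < c * dep q" using l by (simp_all add: dep_simps)
    then show ?thesis using np[of p] np[of q] by auto
  next
    case False
    then have "c < 0" using u by (cases "c = 0") auto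
    then have "0 < c * dep t" if "t \<in> T" for t using m(1)[OF that] that by (simp add: dep_simps mult_neg_pos)
    then have "T \<subseteq> W" using np by force
    then show ?thesis using pq by simp
  qed
  then have "u \<in> A" using u pq by auto
  then show False using u by (simp add: dep_simps)
qed

lemma hull_closed_face:
  assumes "circuit_closed A T p q W" shows "convex hull W face_of convex hull U"
  using assms closed_hulls_disjoint[OF assms] finite_AT
  by (intro face_of_convex_hulls) (auto simp: circuit_closed_def)

lemma hull_closed_Int:
  assumes W: "circuit_closed A T p q W" shows "convex hull W \<inter> U = W"
proof (intro equalityI subsetI)
  fix v assume v: "v \<in> convex hull W \<inter> U"
  show "v \<in> W"
  proof (rule ccontr)
    assume "v \<notin> W"
    then have "v \<in> convex hull (U - W)" using v by (intro hull_inc) auto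
    moreover have "v \<in> affine hull W" using v convex_hull_subset_affine_hull by blast
    ultimately show False using closed_hulls_disjoint[OF W] by blast
  qed
next
  fix v assume "v \<in> W"
  moreover have "W \<subseteq> U" using W by (simp add: circuit_closed_def)
  ultimately show "v \<in> convex hull W \<inter> U" by (intro IntI hull_inc) blast+
qed

text \<open>The crossing point \<open>?z\<close> is interior to the segment from \<open>p\<close> to
  \<open>q\<close> and relatively interior to the hull of \<open>T\<close>. A face containing either
  side contains \<open>?z\<close> and therefore the other side.\<close>

lemma face_Int_closed:
  assumes F: "F face_of convex hull U"
  shows "circuit_closed A T p q (F \<inter> U)" "F = convex hull (F \<inter> U)"
proof -
  let ?z = "l *\<^sub>R p + (1 - l) *\<^sub>R q"
  have conv: "convex F" using F face_of_imp_convex by blast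
  have UU: "v \<in> convex hull U" if "v \<in> U" for v using that by (rule hull_inc)
  have "\<not> affine_dependent T" by (rule affine_independent_subset[OF indep]) auto
  then have zT: "?z \<in> rel_interior (convex hull T)"
    using circuit m by (auto simp: rel_interior_convex_hull_explicit)
  have seg: "?z \<in> open_segment p q"
    using l disj(4) by (auto simp: in_segment intro!: exI[of _ "1 - l"])
  have "T \<subseteq> F" if pq: "p \<in> F" "q \<in> F"
  proof -
    have "?z \<in> F" using convexD[OF conv pq] l by simp
    moreover have "convex hull T \<subseteq> convex hull U" by (rule hull_mono) auto
    ultimately have "convex hull T \<subseteq> F" using subset_of_face_of[OF F] zT by blast
    then show ?thesis using hull_subset[of T convex] by blast
  qed
  moreover have "p \<in> F \<and> q \<in> F" if "T \<subseteq> F"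
  proof -
    have "convex hull T \<subseteq> F" using that conv by (simp add: hull_minimal)
    then have "?z \<in> F" using zT rel_interior_subset by blast
    then show ?thesis using face_ofD[OF F seg] UU by simp
  qed
  ultimately show "circuit_closed A T p q (F \<inter> U)" by (auto simp: circuit_closed_def)
  obtain S where S: "S \<subseteq> U" "F = convex hull S"
    using face_of_convex_hull_subset[OF _ F] finite_AT finite_imp_compact[of U] by auto
  have "S \<subseteq> F \<inter> U" using S hull_subset[of S convex] by blast
  then have "F \<subseteq> convex hull (F \<inter> U)" using S(2) hull_mono by blast
  moreover have "convex hull (F \<inter> U) \<subseteq> F" using conv by (simp add: hull_minimal)
  ultimately show "F = convex hull (F \<inter> U)" by blast
qed

lemma faces_bij: "bij_betw (\<lambda>F. F \<inter> U) {F. F face_of convex hull U} (Collect (circuit_closed A T p q))"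
proof (rule bij_betw_byWitness[where f' = "\<lambda>W. convex hull W"])
  show "\<forall>F\<in>{F. F face_of convex hull U}. convex hull (F \<inter> U) = F"
    using face_Int_closed(2) by auto
  show "\<forall>W\<in>Collect (circuit_closed A T p q). convex hull W \<inter> U = W"
    using hull_closed_Int by blast
  show "(\<lambda>F. F \<inter> U) ` {F. F face_of convex hull U} \<subseteq> Collect (circuit_closed A T p q)"
    using face_Int_closed(1) by blast
  show "(\<lambda>W. convex hull W) ` Collect (circuit_closed A T p q) \<subseteq> {F. F face_of convex hull U}"
    using hull_closed_face by blast
qed

lemma faces_subset_iff:
  assumes "F face_of convex hull U" "G face_of convex hull U"
  shows "F \<subseteq> G \<longleftrightarrow> F \<inter> U \<subseteq> G \<inter> U"
proof
  assume "F \<inter> U \<subseteq> G \<inter> U"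
  then have "convex hull (F \<inter> U) \<subseteq> convex hull (G \<inter> U)" by (rule hull_mono)
  then show "F \<subseteq> G" using face_Int_closed(2)[OF assms(1)] face_Int_closed(2)[OF assms(2)] by metis
qed auto

end

section \<open>From \<open>is_T1_pyramid\<close> to circuits, and existence\<close>

definition is_circuit_polytope :: "nat \<Rightarrow> nat \<Rightarrow> 'a::euclidean_space set \<Rightarrow> bool"
  where "is_circuit_polytope s r Q \<longleftrightarrow> (\<exists>A T p q l m. circuit_config A T p q l m \<and>
           card A = r \<and> card T = s \<and> Q = convex hull (insert p (insert q (A \<union> T))))"

text \<open>The functional equals \<open>b\<close> at all vertices but \<open>u\<close>, so its
  value at \<open>x\<close> depends only on the barycentric coordinate of \<open>u\<close>: negative
  means beyond the facet opposite \<open>u\<close>, positive means beneath it.\<close>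

lemma simplex_facet_functional:
  fixes C :: "'a::euclidean_space set"
  assumes C: "\<not> affine_dependent C" "u \<in> C"
    and a: "\<forall>y\<in>convex hull C. a \<bullet> y \<le> b" "convex hull (C - {u}) = convex hull C \<inter> {y. a \<bullet> y = b}"
    and \<beta>: "sum \<beta> C = 1" "(\<Sum>c\<in>C. \<beta> c *\<^sub>R c) = x"
  shows "a \<bullet> u < b" "a \<bullet> x = b + \<beta> u * (a \<bullet> u - b)"
proof -
  have fin: "finite C" using aff_independent_finite C by blast
  have "u \<notin> affine hull (C - {u})" using C by (auto simp: affine_dependent_def)
  then have "u \<notin> convex hull (C - {u})" using convex_hull_subset_affine_hull by blast
  moreover have "u \<in> convex hull C" using C(2) by (rule hull_inc)
  ultimately have "a \<bullet> u \<noteq> b" "a \<bullet> u \<le> b" using a by auto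
  then show "a \<bullet> u < b" by simp
  have on: "a \<bullet> c = b" if "c \<in> C - {u}" for c
  proof -
    have "c \<in> convex hull (C - {u})" using that by (rule hull_inc)
    then show ?thesis using a(2) by blast
  qed
  have "a \<bullet> x = (\<Sum>c\<in>C. \<beta> c * (a \<bullet> c))" using \<beta>(2) by (auto simp: inner_sum_right)
  also have "\<dots> = \<beta> u * (a \<bullet> u) + (\<Sum>c\<in>C - {u}. \<beta> c * (a \<bullet> c))"
    by (rule sum.remove[OF fin C(2)])
  also have "(\<Sum>c\<in>C - {u}. \<beta> c * (a \<bullet> c)) = (\<Sum>c\<in>C - {u}. \<beta> c * b)"
    using on by simp
  also have "(\<Sum>c\<in>C - {u}. \<beta> c * b) = (1 - \<beta> u) * b"
    using sum.remove[OF fin C(2), of \<beta>] \<beta>(1) by (simp add: sum_distrib_right[symmetric])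
  finally show "a \<bullet> x = b + \<beta> u * (a \<bullet> u - b)" by (simp add: algebra_simps)
qed

lemma is_T1_circuit:
  assumes "is_T1 s Q" shows "is_circuit_polytope s 0 Q"
proof -
  obtain S x F where S: "int s simplex S" and bey: "beyond x F S"
    and bn: "\<And>G. G facet_of S \<Longrightarrow> G \<noteq> F \<Longrightarrow> beneath x G S" and Q: "Q = convex hull (insert x S)"
    using assms by (auto simp: is_T1_def)
  obtain C where C: "\<not> affine_dependent C" "card C = Suc s" "S = convex hull C"
    using S by (auto simp: simplex_def)
  have fin: "finite C" using aff_independent_finite C by blast
  have FS: "F facet_of S" using bey by (simp add: beyond_def)
  then obtain p where p: "p \<in> C" "F = convex hull (C - {p})"
    using facet_of_convex_hull_affine_independent[OF C(1)] C(3) by blast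
  have "x \<in> affine hull C" using bey C(3) by (simp add: beyond_def)
  then obtain \<beta> where \<beta>: "sum \<beta> C = 1" "(\<Sum>c\<in>C. \<beta> c *\<^sub>R c) = x"
    using affine_hull_finite[OF fin] by auto
  obtain a b where ab: "\<forall>y\<in>S. a \<bullet> y \<le> b" "F = S \<inter> {y. a \<bullet> y = b}" "b < a \<bullet> x"
    using bey by (auto simp: beyond_def)
  have "a \<bullet> p < b" "a \<bullet> x = b + \<beta> p * (a \<bullet> p - b)"
    using simplex_facet_functional[OF C(1) p(1) _ _ \<beta>, of a b] ab p C by auto
  then have \<beta>p: "\<beta> p < 0" using ab(3) by (smt (verit) mult_nonneg_nonpos)
  have xS: "x \<notin> S" using ab by force
  have \<beta>t: "0 < \<beta> t" if t: "t \<in> C - {p}" for t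
  proof -
    let ?G = "convex hull (C - {t})"
    have pG: "p \<in> ?G" using p t by (intro hull_inc) auto
    then have "?G facet_of S"
      using C(3) t facet_of_convex_hull_affine_independent[OF C(1), of ?G] by blast
    moreover have "p \<notin> affine hull (C - {p})" using C p by (auto simp: affine_dependent_def)
    then have "p \<notin> F" using p convex_hull_subset_affine_hull by blast
    then have "?G \<noteq> F" using pG by auto
    ultimately have "beneath x ?G S" by (rule bn)
    then obtain a b where ab: "\<forall>y\<in>S. a \<bullet> y \<le> b" "?G = S \<inter> {y. a \<bullet> y = b}" "a \<bullet> x < b"
      by (auto simp: beneath_def)
    have "a \<bullet> t < b" "a \<bullet> x = b + \<beta> t * (a \<bullet> t - b)"
      using simplex_facet_functional[OF C(1) _ _ _ \<beta>, of t a b] ab t C by auto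
    then show ?thesis using ab(3) by (smt (verit) mult_nonpos_nonpos)
  qed
  define T where "T = C - {p}"
  \<comment> \<open>Only \<open>\<beta> p\<close> is negative. Moving its term to the side of
    \<open>x\<close> and dividing by \<open>1 - \<beta> p\<close> turns the barycentric
    representation into the circuit, with \<open>x\<close> as \<open>q\<close>.\<close>
  define l where "l = - \<beta> p / (1 - \<beta> p)"
  define m where "m t = \<beta> t / (1 - \<beta> p)" for t
  have pos: "0 < 1 - \<beta> p" using \<beta>p by simp
  have sumT: "sum \<beta> T = 1 - \<beta> p" "(\<Sum>c\<in>T. \<beta> c *\<^sub>R c) = x - \<beta> p *\<^sub>R p"
    using sum.remove[OF fin p(1), of \<beta>] sum.remove[OF fin p(1), of "\<lambda>c. \<beta> c *\<^sub>R c"] \<beta> by (auto simp: T_def)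
  have CT: "C = insert p T" "p \<notin> T" using p by (auto simp: T_def)
  have xC: "x \<notin> C" using xS C(3) hull_inc[of x C convex] by auto
  have "circuit_config {} T p x l m"
  proof
    show "\<not> affine_dependent (insert p ({} \<union> T))" using C CT by simp
    show "0 < l" "l < 1" using \<beta>p by (auto simp: l_def field_simps)
    show "0 < m t" if "t \<in> T" for t using \<beta>t pos that by (simp add: m_def T_def)
    show "sum m T = 1" using sumT pos by (simp add: m_def sum_divide_distrib[symmetric])
    have "(\<Sum>t\<in>T. m t *\<^sub>R t) = inverse (1 - \<beta> p) *\<^sub>R (\<Sum>t\<in>T. \<beta> t *\<^sub>R t)"
      by (simp add: m_def scaleR_sum_right divide_inverse mult.commute)
    moreover have "1 - l = inverse (1 - \<beta> p)" using pos by (simp add: l_def field_simps)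
    moreover have "l = - \<beta> p * inverse (1 - \<beta> p)" by (simp add: l_def divide_inverse)
    ultimately show "l *\<^sub>R p + (1 - l) *\<^sub>R x = (\<Sum>t\<in>T. m t *\<^sub>R t)"
      using sumT(2) by (simp add: scaleR_diff_right mult.commute)
  qed (use CT xC in auto)
  moreover have "card T = s" using C CT fin by simp
  moreover have "Q = convex hull (insert p (insert x ({} \<union> T)))"
    using Q C(3) CT by (simp add: hull_insert[symmetric] insert_commute)
  ultimately show ?thesis unfolding is_circuit_polytope_def
    by (intro exI[of _ "{}"] exI[of _ T] exI[of _ p] exI[of _ x] exI[of _ l] exI[of _ m]) auto
qed

text \<open>A new apex lies outside the affine hull, so it has coefficient zero in the dependency
  and joins \<open>A\<close>.\<close>

lemma pyramid_circuit:
  assumes "is_circuit_polytope s r Q" "pyramid_over Q R" shows "is_circuit_polytope s (Suc r) R"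
proof -
  obtain A T p q l m where cc: "circuit_config A T p q l m" and card: "card A = r" "card T = s"
    and Q: "Q = convex hull (insert p (insert q (A \<union> T)))"
    using assms(1) by (auto simp: is_circuit_polytope_def)
  interpret circuit_config A T p q l m by (rule cc)
  obtain a where a: "a \<notin> affine hull Q" "R = convex hull (insert a Q)"
    using assms(2) by (auto simp: pyramid_over_def)
  have aU: "a \<notin> affine hull U" using a Q by simp
  then have aU': "a \<notin> U" using hull_inc[of a U affine] by blast
  have "affine hull (insert p (A \<union> T)) \<subseteq> affine hull U" by (rule hull_mono) auto
  then have "\<not> affine_dependent (insert a (insert p (A \<union> T)))"
    using aU by (intro affine_independent_insert[OF indep]) blast
  then have "circuit_config (insert a A) T p q l m"
    using disj l m circuit aU' by unfold_locales (auto simp: insert_commute)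
  moreover have "R = convex hull (insert p (insert q (insert a A \<union> T)))"
    using a Q by (simp add: hull_insert[symmetric] insert_commute)
  moreover have "card (insert a A) = Suc r" using aU' card finite_AT by simp
  ultimately show ?thesis using card unfolding is_circuit_polytope_def by blast
qed

lemma is_T1_pyramid_circuit:
  assumes "is_T1_pyramid s r R" shows "is_circuit_polytope s r R"
proof -
  obtain Q where Q: "is_T1 s Q" "(pyramid_over ^^ r) Q R" using assms by (auto simp: is_T1_pyramid_def)
  from Q(2) show ?thesis
  proof (induction r arbitrary: R)
    case 0
    then show ?case using is_T1_circuit[OF Q(1)] by simp
  next
    case (Suc r)
    from Suc.prems obtain R' where "(pyramid_over ^^ r) Q R'" "pyramid_over R' R"
      by (auto elim: relpowp_Suc_E)
    then show ?case using Suc.IH pyramid_circuit by blast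
  qed
qed

text \<open>The point is the reflection of a vertex \<open>p\<close> in the centroid of the opposite
  facet: its coordinates \<open>-1\<close> at \<open>p\<close> and \<open>2 / s\<close> elsewhere
  have the required signs and sum to \<open>1\<close>.\<close>

lemma ex_T1_in_affine_hull:
  fixes C :: "'a::euclidean_space set"
  assumes C: "\<not> affine_dependent C" "card C = Suc s" "1 \<le> s"
  obtains x where "x \<in> affine hull C" "is_T1 s (convex hull (insert x C))"
proof -
  have fin: "finite C" using aff_independent_finite C by blast
  obtain p where p: "p \<in> C" using C(2) by fastforce
  define \<beta> where "\<beta> c = (if c = p then -1 else 2 / real s)" for c
  define x where "x = (\<Sum>c\<in>C. \<beta> c *\<^sub>R c)"
  have "sum \<beta> C = \<beta> p + sum \<beta> (C - {p})" using sum.remove[OF fin p] .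
  also have "sum \<beta> (C - {p}) = (\<Sum>c\<in>C - {p}. 2 / real s)" by (rule sum.cong) (auto simp: \<beta>_def)
  also have "\<dots> = 2" using C p fin by simp
  finally have \<beta>: "sum \<beta> C = 1" by (simp add: \<beta>_def)
  have x: "x \<in> affine hull C" using affine_hull_finite[OF fin] \<beta> x_def by blast
  have poly: "polyhedron (convex hull C)" using fin by (simp add: polytope_convex_hull polytope_imp_polyhedron)
  have facet: "convex hull (C - {u}) facet_of convex hull C" if u: "u \<in> C" for u
  proof -
    have "card (C - {u}) = s" using u C(2) fin by simp
    then have "C - {u} \<noteq> {}" using C(3) by (metis card.empty not_one_le_zero)
    then show ?thesis using u facet_of_convex_hull_affine_independent[OF C(1)] by auto
  qed
  have fun_: "\<exists>a b. (\<forall>y\<in>convex hull C. a \<bullet> y \<le> b) \<and> convex hull (C - {u}) = convex hull C \<inter> {y. a \<bullet> y = b}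
      \<and> a \<bullet> u < b \<and> a \<bullet> x = b + \<beta> u * (a \<bullet> u - b)" if u: "u \<in> C" for u
  proof -
    obtain a b where ab: "convex hull C \<subseteq> {y. a \<bullet> y \<le> b}"
        "convex hull (C - {u}) = convex hull C \<inter> {y. a \<bullet> y = b}"
      by (rule facet_of_polyhedron[OF poly facet[OF u]]) (rule that)
    then have "\<forall>y\<in>convex hull C. a \<bullet> y \<le> b" by blast
    then show ?thesis using simplex_facet_functional[OF C(1) u _ ab(2) \<beta> x_def[symmetric]] ab(2)
      by (intro exI[of _ a] exI[of _ b] conjI)
  qed
  have "beyond x (convex hull (C - {p})) (convex hull C)"
  proof -
    obtain a b where ab: "\<forall>y\<in>convex hull C. a \<bullet> y \<le> b" "convex hull (C - {p}) = convex hull C \<inter> {y. a \<bullet> y = b}"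
      "a \<bullet> p < b" "a \<bullet> x = b + \<beta> p * (a \<bullet> p - b)" using fun_[OF p] by blast
    then have "b < a \<bullet> x" by (simp add: \<beta>_def)
    then show ?thesis unfolding beyond_def affine_hull_convex_hull
      using facet[OF p] x ab(1,2) by (intro conjI exI[of _ a] exI[of _ b])
  qed
  moreover have "beneath x G (convex hull C)" if G: "G facet_of convex hull C" "G \<noteq> convex hull (C - {p})" for G
  proof -
    obtain u where u: "u \<in> C" "G = convex hull (C - {u})"
      using G(1) facet_of_convex_hull_affine_independent[OF C(1)] by blast
    obtain a b where ab: "\<forall>y\<in>convex hull C. a \<bullet> y \<le> b" "convex hull (C - {u}) = convex hull C \<inter> {y. a \<bullet> y = b}"
      "a \<bullet> u < b" "a \<bullet> x = b + \<beta> u * (a \<bullet> u - b)" using fun_[OF u(1)] by blast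
    have "0 < \<beta> u" using u G C(3) by (auto simp: \<beta>_def)
    then have "\<beta> u * (a \<bullet> u - b) < 0" using ab(3) by (simp add: mult_pos_neg)
    then have "a \<bullet> x < b" using ab(4) by simp
    then show ?thesis unfolding beneath_def u(2) affine_hull_convex_hull
      using facet[OF u(1)] x ab(1,2) by (intro conjI exI[of _ a] exI[of _ b])
  qed
  moreover have "int s simplex (convex hull C)" using C by (auto simp: simplex_def)
  moreover have "convex hull (insert x C) = convex hull (insert x (convex hull C))"
    by (rule hull_insert)
  ultimately have "is_T1 s (convex hull (insert x C))" unfolding is_T1_def by blast
  with x show ?thesis by (rule that)
qed

text \<open>The bipyramid is built on \<open>s + 1\<close> points of \<open>B\<close>. As
  \<open>x\<close> stays in their affine hull, each remaining point of \<open>B\<close> lies outside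
  the affine hull of what precedes it and can be the next apex.\<close>

lemma ex_T1_pyramid:
  fixes B :: "'a::euclidean_space set"
  assumes B: "\<not> affine_dependent B" "card B = Suc d" and s: "1 \<le> s" "s \<le> d"
  shows "\<exists>Q :: 'a set. is_T1_pyramid s (d - s) Q"
proof -
  obtain C where C: "C \<subseteq> B" "card C = Suc s" "finite C"
    using obtain_subset_with_card_n[of "Suc s" B] B s by auto
  have finB: "finite B" using aff_independent_finite B by blast
  have "\<not> affine_dependent C" using affine_independent_subset B C by blast
  then obtain x where x: "x \<in> affine hull C" "is_T1 s (convex hull (insert x C))"
    using ex_T1_in_affine_hull C s by blast
  have "E \<subseteq> B - C \<Longrightarrow> (pyramid_over ^^ card E) (convex hull (insert x C)) (convex hull (insert x (C \<union> E)))"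
    if "finite E" for E
    using that
  proof (induction E rule: finite_induct)
    case (insert e E)
    have "affine hull (insert x (C \<union> E)) = affine hull (C \<union> E)"
      using x(1) hull_mono[of C "C \<union> E" affine] by (intro hull_redundant) auto
    moreover have "e \<notin> affine hull (C \<union> E)"
    proof -
      have "e \<notin> affine hull (B - {e})" using B insert.prems by (auto simp: affine_dependent_def)
      moreover have "C \<union> E \<subseteq> B - {e}" using C insert.prems insert.hyps by auto
      ultimately show ?thesis using hull_mono by blast
    qed
    ultimately have "pyramid_over (convex hull (insert x (C \<union> E)))
        (convex hull (insert e (convex hull (insert x (C \<union> E)))))"
      by (auto simp: pyramid_over_def)
    moreover have "convex hull (insert e (convex hull (insert x (C \<union> E)))) = convex hull (insert x (C \<union> insert e E))"
      by (simp add: hull_insert[symmetric] insert_commute)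
    ultimately have "(pyramid_over ^^ Suc (card E)) (convex hull (insert x C)) (convex hull (insert x (C \<union> insert e E)))"
      using insert.IH insert.prems by (intro relpowp_Suc_I) auto
    then show ?case using insert.hyps by simp
  qed simp
  from this[of "B - C"] have "(pyramid_over ^^ card (B - C)) (convex hull (insert x C)) (convex hull (insert x (C \<union> (B - C))))"
    using finB by simp
  moreover have "card (B - C) = d - s" using C B finB by (simp add: card_Diff_subset)
  ultimately show ?thesis using x(2) unfolding is_T1_pyramid_def by metis
qed

section \<open>Comparison of the two lattices\<close>

lemma combinatorially_equivalent_if_common_dual:
  assumes "dual_polytope P Q" "dual_polytope P' Q"
  shows "combinatorially_equivalent P P'"
proof -
  let ?Q = "{F. F face_of Q}" and ?P = "{F. F face_of P}" and ?P' = "{F. F face_of P'}"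
  obtain f where f: "bij_betw f ?Q ?P"
    and f': "\<And>F F'. F face_of Q \<Longrightarrow> F' face_of Q \<Longrightarrow> F \<subseteq> F' \<longleftrightarrow> f F' \<subseteq> f F"
    using assms(1) unfolding dual_polytope_def by blast
  obtain g where g: "bij_betw g ?Q ?P'"
    and g': "\<And>F F'. F face_of Q \<Longrightarrow> F' face_of Q \<Longrightarrow> F \<subseteq> F' \<longleftrightarrow> g F' \<subseteq> g F"
    using assms(2) unfolding dual_polytope_def by blast
  let ?i = "inv_into ?Q f"
  have i: "?i F face_of Q" "f (?i F) = F" if "F face_of P" for F
    using bij_betw_apply[OF bij_betw_inv_into[OF f], of F] bij_betw_inv_into_right[OF f, of F] that by auto
  have "bij_betw (g \<circ> ?i) ?P ?P'"
    using bij_betw_inv_into[OF f] g by (rule bij_betw_trans)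
  moreover have "F \<subseteq> F' \<longleftrightarrow> (g \<circ> ?i) F \<subseteq> (g \<circ> ?i) F'" if "F face_of P" "F' face_of P" for F F'
    using f'[OF i(1)[OF that(2)] i(1)[OF that(1)]] g'[OF i(1)[OF that(2)] i(1)[OF that(1)]]
      i(2)[OF that(1)] i(2)[OF that(2)] by simp
  ultimately show ?thesis unfolding combinatorially_equivalent_def by blast
qed

lemma bij_betw_face_sets:
  "polytope P \<Longrightarrow> bij_betw (\<lambda>F. F \<inter> verts P) {F. F face_of P} (face_sets P)"
  unfolding face_sets_def by (rule inj_on_imp_bij_betw[OF inj_on_Int_verts])

lemma extremal_polytope_dual:
  fixes P :: "'a::euclidean_space set" and Q :: "'b::euclidean_space set"
  assumes P: "polytope P" and E: "extremal_face_lattice (verts P) (face_sets P) face_rank d s k"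
    and Q: "is_circuit_polytope s (d - s) Q"
  shows "dual_polytope P Q"
proof -
  obtain A T p q l m where cc: "circuit_config A T p q l m" and card: "card A = d - s" "card T = s"
    and QU: "Q = convex hull (insert p (insert q (A \<union> T)))"
    using Q by (auto simp: is_circuit_polytope_def)
  interpret E: extremal_face_lattice "verts P" "face_sets P" face_rank d s k by (rule E)
  interpret Q: circuit_config A T p q l m by (rule cc)
  obtain h where h: "bij_betw h (Collect (circuit_closed A T p q)) (face_sets P)"
    and anti: "\<And>W W'. circuit_closed A T p q W \<Longrightarrow> circuit_closed A T p q W' \<Longrightarrow> W \<subseteq> W' \<longleftrightarrow> h W' \<subseteq> h W"
    using E.ex_antiisomorphism[OF Q.finite_AT _ card(2) Q.disj] card(1) E.s(2) by auto
  let ?P = "{F. F face_of P}" and ?v = "\<lambda>F. F \<inter> verts P"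
  let ?i = "inv_into ?P ?v"
  note vb = bij_betw_face_sets[OF P]
  have i: "?i W face_of P" "?v (?i W) = W" if "W \<in> face_sets P" for W
    using bij_betw_apply[OF bij_betw_inv_into[OF vb] that] bij_betw_inv_into_right[OF vb that] by auto
  let ?h = "?i \<circ> (h \<circ> (\<lambda>F. F \<inter> Q.U))"
  have "bij_betw ?h {F. F face_of Q} ?P"
    using bij_betw_trans[OF bij_betw_trans[OF Q.faces_bij h] bij_betw_inv_into[OF vb]] QU by simp
  moreover have "F \<subseteq> F' \<longleftrightarrow> ?h F' \<subseteq> ?h F" if F: "F face_of Q" "F' face_of Q" for F F'
  proof -
    have c: "circuit_closed A T p q (F \<inter> Q.U)" "circuit_closed A T p q (F' \<inter> Q.U)"
      using Q.face_Int_closed(1) F QU by auto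
    then have hh: "h (F \<inter> Q.U) \<in> face_sets P" "h (F' \<inter> Q.U) \<in> face_sets P"
      using bij_betw_apply[OF h] by auto
    have "F \<subseteq> F' \<longleftrightarrow> F \<inter> Q.U \<subseteq> F' \<inter> Q.U" using Q.faces_subset_iff F QU by simp
    also have "\<dots> \<longleftrightarrow> h (F' \<inter> Q.U) \<subseteq> h (F \<inter> Q.U)" by (rule anti[OF c])
    also have "\<dots> \<longleftrightarrow> ?h F' \<subseteq> ?h F"
      using face_subset_iff_verts[OF P i(1)[OF hh(2)] i(1)[OF hh(1)]] i(2)[OF hh(1)] i(2)[OF hh(2)] by simp
    finally show ?thesis .
  qed
  ultimately show ?thesis unfolding dual_polytope_def using P by blast
qed

theorem theorem4p4:
  fixes P :: "'a::euclidean_space set" and d s k :: nat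
  assumes "2 \<le> s" and "s \<le> d"
    and "polytope P" and "aff_dim P = int d"
    and "card {v. v extreme_point_of P} = d + s"
    and "1 \<le> k" and "k \<le> d - 2"
    and "int (face_count k P) =
           int ((d + 1) choose (k + 1)) + int (d choose (k + 1))
           - int ((d + 1 - s) choose (k + 1))"
  shows "(\<exists>(Q :: 'a set) (Q' :: 'a set).
            is_T1_pyramid s (d - s) Q \<and> dual_polytope Q' Q \<and> combinatorially_equivalent P Q')
       \<and> (\<forall>(Q :: 'b::euclidean_space set) (Q' :: 'c::euclidean_space set).
            is_T1_pyramid s (d - s) Q \<longrightarrow> dual_polytope Q' Q \<longrightarrow> combinatorially_equivalent P Q')"
proof -
  note P = assms(3)
  interpret face_lattice "verts P" "face_sets P" face_rank by (rule polytope_face_lattice[OF P])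
  have "aff_dim (verts P) = int d"
    using polytope_eq_hull_verts[OF P] aff_dim_convex_hull[of "verts P"] assms(4) by simp
  then have rkV: "face_rank (verts P) = Suc d" by (simp add: face_rank_def)
  have "faces_between {} (verts P) (Suc k) = {W\<in>face_sets P. face_rank W = Suc k}"
    using face_subset by (auto simp: faces_between_def)
  then have "card (faces_between {} (verts P) (Suc k)) = face_count k P"
    using card_rank_faces[OF P] by simp
  then have "int (card (faces_between {} (verts P) (Suc k)) + ((Suc d - s) choose Suc k))
      = int ((Suc d choose Suc k) + (d choose Suc k))"
    using assms(8) by simp
  then have eq: "card (faces_between {} (verts P) (Suc k)) + ((Suc d - s) choose Suc k)
      = (Suc d choose Suc k) + (d choose Suc k)"
    by (simp only: of_nat_eq_iff)
  \<comment> \<open>The subtraction in \<open>d - 2\<close> is not truncated, since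
    \<open>2 \<le> s \<le> d\<close>.\<close>
  have "k + 2 \<le> d" using assms(1,2,6,7) by linarith
  then have E: "extremal_face_lattice (verts P) (face_sets P) face_rank d s k"
    using rkV eq assms(1,2,5,6) by unfold_locales (simp_all add: verts_def)
  have dualB: "dual_polytope P Q" if "is_T1_pyramid s (d - s) Q" for Q :: "'b set"
    using extremal_polytope_dual[OF P E is_T1_pyramid_circuit[OF that]] .
  have dualA: "dual_polytope P Q" if "is_T1_pyramid s (d - s) Q" for Q :: "'a set"
    using extremal_polytope_dual[OF P E is_T1_pyramid_circuit[OF that]] .
  \<comment> \<open>An affine basis of the hull of \<open>P\<close> has the \<open>d + 1\<close>
    points needed to realize the pyramid in the space of \<open>P\<close>; the witness for
    \<open>Q'\<close> is then \<open>P\<close> itself.\<close>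
  obtain B where B: "\<not> affine_dependent B" "affine hull P = affine hull B"
    using affine_basis_exists[of P] by blast
  have "card B = Suc d" using aff_dim_unique[of B P] B assms(4) by simp
  then obtain Q :: "'a set" where Q: "is_T1_pyramid s (d - s) Q"
    using ex_T1_pyramid[OF B(1)] assms(1,2) by (metis one_le_numeral order_trans)
  note equiv = combinatorially_equivalent_if_common_dual
  show ?thesis
  proof (intro conjI allI impI)
    show "\<exists>(Q :: 'a set) (Q' :: 'a set).
        is_T1_pyramid s (d - s) Q \<and> dual_polytope Q' Q \<and> combinatorially_equivalent P Q'"
      using Q dualA[OF Q] equiv[OF dualA[OF Q] dualA[OF Q]]
      by (intro exI[of _ Q] exI[of _ P] conjI)
  next
    fix Q :: "'b set" and Q' :: "'c set"
    assume "is_T1_pyramid s (d - s) Q" "dual_polytope Q' Q"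
    then show "combinatorially_equivalent P Q'" by (intro equiv[OF dualB])
  qed
qed

end
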